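(* Let $n\ge2$, $N\ge2$, and let $\mathcal{K}$ be a categorical $\mathfrak{U}_n^+$-action. Let $\underline{k}=(k_1,\dots,k_n)\in C(n,N)$ and let $\eta=(0,\dots,0,N)$ be the highest weight. Consider the functors $\mathsf{E}_{1,\boldsymbol\lambda(1)}\cdots\mathsf{E}_{n-1,\boldsymbol\lambda(n-1)}\mathbf{1}_\eta:\mathcal{K}(\eta)\to\mathcal{K}(\underline{k})$, where $\boldsymbol\lambda(i)\in P(k_{i+1},\sum_{j=1}^ik_j)$ for all $1\le i\le n-1$. Then: (1) They are all fully faithful, i.e. $$\mathrm{Hom}(\mathsf{E}_{1,\boldsymbol\lambda(1)}\cdots\mathsf{E}_{n-1,\boldsymbol\lambda(n-1)}\mathbf{1}_\eta,\ \mathsf{E}_{1,\boldsymbol\lambda(1)}\cdots\mathsf{E}_{n-1,\boldsymbol\lambda(n-1)}\mathbf{1}_\eta)\cong\mathrm{Hom}(\mathbf{1}_\eta,\mathbf{1}_\eta).$$ (2) They satisfy the semiorthogonal property $$\mathrm{Hom}(\mathsf{E}_{1,\boldsymbol\lambda(1)}\cdots\mathsf{E}_{n-1,\boldsymbol\lambda(n-1)}\mathbf{1}_\eta,\ \mathsf{E}_{1,\boldsymbol\lambda(1)'}\cdots\mathsf{E}_{n-1,\boldsymbol\lambda(n-1)'}\mathbf{1}_\eta)\cong0$$ whenever $(\boldsymbol\lambda(1),\dots,\boldsymbol\lambda(n-1))<_{pl}(\boldsymbol\lambda(1)',\dots,\boldsymbol\lambda(n-1)')$, where $\boldsymbol\lambda(i),\boldsymbol\lambda(i)'\in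 P(k_{i+1},\sum_{j=1}^ik_j)$ and $<_{pl}$ is the product lexicographical order.
   Context: $C(n,N)=\{\underline{k}=(k_1,\dots,k_n)\in\mathbb{Z}_{\ge0}^n:\sum k_i=N\}$. For $1\le i\le n-1$, $\alpha_i=(0,\dots,0,-1,1,0,\dots,0)$ with $-1$ in position $i$ and $1$ in position $i+1$. A categorical $\mathfrak{U}_n^+$-action consists of a target 2-category $\mathcal{K}$, which is triangulated, $\mathbb{C}$-linear and idempotent complete, with objects $\mathcal{K}(\underline{k})$, $\underline{k}\in C(n,N)$, where each $\mathcal{K}(\underline{k})$ is a triangulated category and each $\mathrm{Hom}(\mathcal{K}(\underline{k}),\mathcal{K}(\underline{l}))$ is triangulated; by convention $\mathcal{K}(\underline{k})=0$ if $\underline{k}\notin C(n,N)$ (so any 1-morphism passing through such a weight is $0$). It has 1-morphisms $\mathbf{1}_{\underline{k}}:\mathcal{K}(\underline{k})\to\mathcal{K}(\underline{k})$ (identity) and $\mathsf{E}_{i,r}\mathbf{1}_{\underline{k}}=\mathbf{1}_{\underline{k}-\alpha_i}\mathsf{E}_{i,r}:\mathcal{K}(\underline{k})\to\mathcal{K}(\underline{k}-\alpha_i)$ for $1\le i\le n-1$, $r\in\mathbb{Z}$, subject to the following conditions for all weights $\underline{k}$ and all $r,s\in\mathbb{Z}$ ($[1]$ is the shift): (1) $\mathsf{E}_{i,r}\mathbf{1}_{\underline{k}}$ has left and right adjoints $\mathsf{E}^L_{i,r}\mathbf{1}_{\underline{k}-\alpha_i}$, $\mathsf{E}^R_{i,r}\mathbf{1}_{\underline{k}-\alpha_i}$.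 (2)(a) $\mathsf{E}_{i,r}\mathsf{E}_{i,s}\mathbf{1}_{\underline{k}}\cong\mathsf{E}_{i,s-1}\mathsf{E}_{i,r+1}\mathbf{1}_{\underline{k}}[1]$ if $r-s\ge0$; $\cong0$ if $r-s=-1$; $\cong\mathsf{E}_{i,s-1}\mathsf{E}_{i,r+1}\mathbf{1}_{\underline{k}}[-1]$ if $r-s\le-2$. (2)(b) There is an exact triangle $\mathsf{E}_{i,r+1}\mathsf{E}_{i+1,s-1}\mathbf{1}_{\underline{k}}\to\mathsf{E}_{i,r}\mathsf{E}_{i+1,s}\mathbf{1}_{\underline{k}}\to\mathsf{E}_{i+1,s}\mathsf{E}_{i,r}\mathbf{1}_{\underline{k}}$. (2)(c) $\mathsf{E}_{i,r}\mathsf{E}_{j,s}\mathbf{1}_{\underline{k}}\cong\mathsf{E}_{j,s}\mathsf{E}_{i,r}\mathbf{1}_{\underline{k}}$ if $|i-j|\ge2$. (3) There are exact triangles $\mathsf{E}_{i,r}\mathsf{E}^R_{i,r}\mathbf{1}_{\underline{k}}\to\mathbf{1}_{\underline{k}}\to\mathsf{E}^R_{i,r-1}\mathsf{E}_{i,r-1}\mathbf{1}_{\underline{k}}$ and $\mathsf{E}^L_{i,r-1}\mathsf{E}_{i,r-1}\mathbf{1}_{\underline{k}}\to\mathbf{1}_{\underline{k}}\to\mathsf{E}_{i,r}\mathsf{E}^L_{i,r}\mathbf{1}_{\underline{k}}$. (4)(a) $\mathsf{E}_{i,r}\mathsf{E}^R_{i,s}\mathbf{1}_{\underline{k}}\cong\mathsf{E}^R_{i,s-1}\mathsf{E}_{i,r-1}\mathbf{1}_{\underline{k}}[-1]$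 if $1\le r-s\le k_i+k_{i+1}-1$; $\mathsf{E}_{i,r}\mathsf{E}^L_{i,s}\mathbf{1}_{\underline{k}}\cong\mathsf{E}^L_{i,s-1}\mathsf{E}_{i,r-1}\mathbf{1}_{\underline{k}}[1]$ if $-k_i-k_{i+1}+1\le r-s\le-1$. (4)(b) $\mathsf{E}_{i,r}\mathsf{E}^R_{i+1,s}\mathbf{1}_{\underline{k}}\cong\mathsf{E}^R_{i+1,s+1}\mathsf{E}_{i,r+1}\mathbf{1}_{\underline{k}}[1]$; $\mathsf{E}_{i,r}\mathsf{E}^R_{i-1,s}\mathbf{1}_{\underline{k}}\cong\mathsf{E}^R_{i-1,s}\mathsf{E}_{i,r}\mathbf{1}_{\underline{k}}$; $\mathsf{E}_{i,r}\mathsf{E}^L_{i+1,s}\mathbf{1}_{\underline{k}}\cong\mathsf{E}^L_{i+1,s}\mathsf{E}_{i,r}\mathbf{1}_{\underline{k}}$; $\mathsf{E}_{i,r}\mathsf{E}^L_{i-1,s}\mathbf{1}_{\underline{k}}\cong\mathsf{E}^L_{i-1,s+1}\mathsf{E}_{i,r+1}\mathbf{1}_{\underline{k}}[-1]$. (4)(c) $\mathsf{E}_{i,r}\mathsf{E}^R_{j,s}\mathbf{1}_{\underline{k}}\cong\mathsf{E}^R_{j,s}\mathsf{E}_{i,r}\mathbf{1}_{\underline{k}}$ and $\mathsf{E}_{i,r}\mathsf{E}^L_{j,s}\mathbf{1}_{\underline{k}}\cong\mathsf{E}^L_{j,s}\mathsf{E}_{i,r}\mathbf{1}_{\underline{k}}$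 for $|i-j|\ge2$. For $a,b\ge0$, $P(a,b)$ is the set of Young diagrams $\boldsymbol\lambda$ with $\lambda_1\le a$ and $\lambda_{b+1}=0$, written $\boldsymbol\lambda=(\lambda_1,\dots,\lambda_b)$ with $a\ge\lambda_1\ge\cdots\ge\lambda_b\ge0$; for such $\boldsymbol\lambda$, $\mathsf{E}_{i,\boldsymbol\lambda}:=\mathsf{E}_{i,\lambda_1}\cdots\mathsf{E}_{i,\lambda_b}$ (identity if $b=0$). Lexicographic order on $P(a,b)$: $\boldsymbol\lambda<_l\boldsymbol\lambda'$ if at the first index $j$ where they differ, $\lambda_j<\lambda'_j$. Product lexicographic order: $(\boldsymbol\lambda(i))_i<_{pl}(\boldsymbol\lambda(i)')_i$ if at the first $i$ where they differ, $\boldsymbol\lambda(i)<_l\boldsymbol\lambda(i)'$. The Homs in (1), (2) are spaces of 2-morphisms, i.e. Homs in the triangulated categories $\mathrm{Hom}(\mathcal{K}(\eta),\mathcal{K}(\underline{k}))$, resp. $\mathrm{Hom}(\mathcal{K}(\eta),\mathcal{K}(\eta))$. *)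

theory Defs
  imports
    Complex_Main
    "HOL-Algebra.Algebraic_Closure_Type"
    "HOL-Library.Function_Algebras"
begin

section \<open>Linear categories over the complex numbers\<close>

abbreviation complex_ring :: "complex ring" where
  "complex_ring \<equiv> ring_of_type_algebra"

text \<open>
  Every set of morphisms is a complex vector space, i.e. a module over the complex numbers;
  the multiplicative fields of the record type are not used. Composition and the action of
  functors on morphisms are not indexed by source and target, as for a category whose
  morphisms determine their source and target.
\<close>

record ('o, 'm) lin_cat =
  Ob :: "'o set"
  Mor :: "'o \<Rightarrow> 'o \<Rightarrow> (complex, 'm) module"
  ide :: "'o \<Rightarrow> 'm"
  cmp :: "'m \<Rightarrow> 'm \<Rightarrow> 'm" (infixl "\<cdot>\<index>" 70)

abbreviation arr :: "('o, 'm, 'z) lin_cat_scheme \<Rightarrow> 'o \<Rightarrow> 'o \<Rightarrow> 'm set" where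
  "arr C x y \<equiv> carrier (Mor C x y)"

definition linear_map :: "(complex, 'a) module \<Rightarrow> (complex, 'b) module \<Rightarrow> ('a \<Rightarrow> 'b) \<Rightarrow> bool" where
  "linear_map V W \<phi> \<longleftrightarrow> \<phi> \<in> carrier V \<rightarrow> carrier W
     \<and> (\<forall>u\<in>carrier V. \<forall>v\<in>carrier V. \<phi> (u \<oplus>\<^bsub>V\<^esub> v) = \<phi> u \<oplus>\<^bsub>W\<^esub> \<phi> v)
     \<and> (\<forall>c. \<forall>v\<in>carrier V. \<phi> (c \<odot>\<^bsub>V\<^esub> v) = c \<odot>\<^bsub>W\<^esub> \<phi> v)"

definition linear_iso :: "(complex, 'a) module \<Rightarrow> (complex, 'b) module \<Rightarrow> ('a \<Rightarrow> 'b) \<Rightarrow> bool" where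
  "linear_iso V W \<phi> \<longleftrightarrow> linear_map V W \<phi> \<and> bij_betw \<phi> (carrier V) (carrier W)"

locale lin_category =
  fixes C :: "('o, 'm, 'z) lin_cat_scheme" (structure)
  assumes hom_space: "\<lbrakk>x \<in> Ob C; y \<in> Ob C\<rbrakk> \<Longrightarrow> module complex_ring (Mor C x y)"
    and ide_in: "x \<in> Ob C \<Longrightarrow> ide C x \<in> arr C x x"
    and linear_post: "\<lbrakk>x \<in> Ob C; y \<in> Ob C; z \<in> Ob C; g \<in> arr C y z\<rbrakk>
      \<Longrightarrow> linear_map (Mor C x y) (Mor C x z) (\<lambda>f. g \<cdot> f)"
    and linear_pre: "\<lbrakk>x \<in> Ob C; y \<in> Ob C; z \<in> Ob C; f \<in> arr C x y\<rbrakk>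
      \<Longrightarrow> linear_map (Mor C y z) (Mor C x z) (\<lambda>g. g \<cdot> f)"
    and cmp_assoc: "\<lbrakk>w \<in> Ob C; x \<in> Ob C; y \<in> Ob C; z \<in> Ob C;
        f \<in> arr C w x; g \<in> arr C x y; h \<in> arr C y z\<rbrakk>
      \<Longrightarrow> (h \<cdot> g) \<cdot> f = h \<cdot> (g \<cdot> f)"
    and ide_left: "\<lbrakk>x \<in> Ob C; y \<in> Ob C; f \<in> arr C x y\<rbrakk> \<Longrightarrow> ide C y \<cdot> f = f"
    and ide_right: "\<lbrakk>x \<in> Ob C; y \<in> Ob C; f \<in> arr C x y\<rbrakk> \<Longrightarrow> f \<cdot> ide C x = f"

definition iso_arr :: "('o, 'm, 'z) lin_cat_scheme \<Rightarrow> 'o \<Rightarrow> 'o \<Rightarrow> 'm \<Rightarrow> bool" where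
  "iso_arr C x y f \<longleftrightarrow> f \<in> arr C x y
     \<and> (\<exists>g\<in>arr C y x. g \<cdot>\<^bsub>C\<^esub> f = ide C x \<and> f \<cdot>\<^bsub>C\<^esub> g = ide C y)"

definition isomorphic :: "('o, 'm, 'z) lin_cat_scheme \<Rightarrow> 'o \<Rightarrow> 'o \<Rightarrow> bool" where
  "isomorphic C x y \<longleftrightarrow> (\<exists>f. iso_arr C x y f)"

definition zero_object :: "('o, 'm, 'z) lin_cat_scheme \<Rightarrow> 'o \<Rightarrow> bool" where
  "zero_object C z \<longleftrightarrow> z \<in> Ob C
     \<and> (\<forall>x\<in>Ob C. arr C x z = {\<zero>\<^bsub>Mor C x z\<^esub>} \<and> arr C z x = {\<zero>\<^bsub>Mor C z x\<^esub>})"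

definition biproduct ::
  "('o, 'm, 'z) lin_cat_scheme \<Rightarrow> 'o \<Rightarrow> 'o \<Rightarrow> 'o \<Rightarrow> bool" where
  "biproduct C x y s \<longleftrightarrow> s \<in> Ob C
     \<and> (\<exists>i\<in>arr C x s. \<exists>j\<in>arr C y s. \<exists>p\<in>arr C s x. \<exists>q\<in>arr C s y.
          p \<cdot>\<^bsub>C\<^esub> i = ide C x \<and> q \<cdot>\<^bsub>C\<^esub> j = ide C y
          \<and> q \<cdot>\<^bsub>C\<^esub> i = \<zero>\<^bsub>Mor C x y\<^esub> \<and> p \<cdot>\<^bsub>C\<^esub> j = \<zero>\<^bsub>Mor C y x\<^esub>
          \<and> (i \<cdot>\<^bsub>C\<^esub> p) \<oplus>\<^bsub>Mor C s s\<^esub> (j \<cdot>\<^bsub>C\<^esub> q) = ide C s)"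

locale additive_category = lin_category C for C :: "('o, 'm, 'z) lin_cat_scheme" (structure) +
  assumes has_zero: "\<exists>z. zero_object C z"
    and has_biproducts: "\<lbrakk>x \<in> Ob C; y \<in> Ob C\<rbrakk> \<Longrightarrow> \<exists>s. biproduct C x y s"

definition idempotent_complete :: "('o, 'm, 'z) lin_cat_scheme \<Rightarrow> bool" where
  "idempotent_complete C \<longleftrightarrow> (\<forall>x\<in>Ob C. \<forall>e\<in>arr C x x. e \<cdot>\<^bsub>C\<^esub> e = e \<longrightarrow>
     (\<exists>y\<in>Ob C. \<exists>p\<in>arr C x y. \<exists>i\<in>arr C y x. i \<cdot>\<^bsub>C\<^esub> p = e \<and> p \<cdot>\<^bsub>C\<^esub> i = ide C y))"

definition linear_functor ::
  "('o, 'm, 'z) lin_cat_scheme \<Rightarrow> ('p, 'q, 'y) lin_cat_scheme \<Rightarrow> ('o \<Rightarrow> 'p) \<Rightarrow> ('m \<Rightarrow> 'q) \<Rightarrow> bool" where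
  "linear_functor C D F F1 \<longleftrightarrow> F \<in> Ob C \<rightarrow> Ob D
     \<and> (\<forall>x\<in>Ob C. \<forall>y\<in>Ob C. linear_map (Mor C x y) (Mor D (F x) (F y)) F1)
     \<and> (\<forall>x\<in>Ob C. F1 (ide C x) = ide D (F x))
     \<and> (\<forall>x\<in>Ob C. \<forall>y\<in>Ob C. \<forall>z\<in>Ob C. \<forall>f\<in>arr C x y. \<forall>g\<in>arr C y z.
          F1 (g \<cdot>\<^bsub>C\<^esub> f) = F1 g \<cdot>\<^bsub>D\<^esub> F1 f)"

definition fully_faithful ::
  "('o, 'm, 'z) lin_cat_scheme \<Rightarrow> ('p, 'q, 'y) lin_cat_scheme \<Rightarrow> ('o \<Rightarrow> 'p) \<Rightarrow> ('m \<Rightarrow> 'q) \<Rightarrow> bool" where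
  "fully_faithful C D F F1 \<longleftrightarrow>
     (\<forall>x\<in>Ob C. \<forall>y\<in>Ob C. bij_betw F1 (arr C x y) (arr D (F x) (F y)))"


section \<open>Triangulated categories\<close>

text \<open>
  An element (x, y, z, f, g, h) of \<open>Tri\<close> is an exact triangle x \<open>\<rightarrow>\<close> y \<open>\<rightarrow>\<close> z \<open>\<rightarrow>\<close> x[1] with
  morphisms f, g, h. The shift is only required to be an autoequivalence.
\<close>

record ('o, 'm) tri_cat = "('o, 'm) lin_cat" +
  sh :: "'o \<Rightarrow> 'o"
  sh1 :: "'m \<Rightarrow> 'm"
  Tri :: "('o \<times> 'o \<times> 'o \<times> 'm \<times> 'm \<times> 'm) set"

text \<open>The object x[-1], which is determined up to isomorphism.\<close>

definition unsh :: "('o, 'm, 'z) tri_cat_scheme \<Rightarrow> 'o \<Rightarrow> 'o" where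
  "unsh C x = (SOME y. y \<in> Ob C \<and> isomorphic C (sh C y) x)"

definition exact_triangle :: "('o, 'm, 'z) tri_cat_scheme \<Rightarrow> 'o \<Rightarrow> 'o \<Rightarrow> 'o \<Rightarrow> bool" where
  "exact_triangle C x y z \<longleftrightarrow> (\<exists>f g h. (x, y, z, f, g, h) \<in> Tri C)"

locale triangulated_category = additive_category C
  for C :: "('o, 'm, 'z) tri_cat_scheme" (structure) +
  assumes shift_functor: "linear_functor C C (sh C) (sh1 C)"
    and shift_fully_faithful: "fully_faithful C C (sh C) (sh1 C)"
    and shift_ess_surj: "x \<in> Ob C \<Longrightarrow> \<exists>y\<in>Ob C. isomorphic C (sh C y) x"
    and tri_typed: "(x, y, z, f, g, h) \<in> Tri C \<Longrightarrow>
      x \<in> Ob C \<and> y \<in> Ob C \<and> z \<in> Ob C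
      \<and> f \<in> arr C x y \<and> g \<in> arr C y z \<and> h \<in> arr C z (sh C x)"
    and tri_iso: "\<lbrakk>(x, y, z, f, g, h) \<in> Tri C;
        x' \<in> Ob C; y' \<in> Ob C; z' \<in> Ob C;
        f' \<in> arr C x' y'; g' \<in> arr C y' z'; h' \<in> arr C z' (sh C x');
        iso_arr C x x' a; iso_arr C y y' b; iso_arr C z z' c;
        b \<cdot> f = f' \<cdot> a; c \<cdot> g = g' \<cdot> b; sh1 C a \<cdot> h = h' \<cdot> c\<rbrakk>
      \<Longrightarrow> (x', y', z', f', g', h') \<in> Tri C"
    and tri_identity: "\<lbrakk>x \<in> Ob C; zero_object C z\<rbrakk>
      \<Longrightarrow> (x, x, z, ide C x, \<zero>\<^bsub>Mor C x z\<^esub>, \<zero>\<^bsub>Mor C z (sh C x)\<^esub>) \<in> Tri C"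
    and tri_cone: "\<lbrakk>x \<in> Ob C; y \<in> Ob C; f \<in> arr C x y\<rbrakk>
      \<Longrightarrow> \<exists>z g h. (x, y, z, f, g, h) \<in> Tri C"
    and tri_rotate: "\<lbrakk>x \<in> Ob C; y \<in> Ob C; z \<in> Ob C;
        f \<in> arr C x y; g \<in> arr C y z; h \<in> arr C z (sh C x)\<rbrakk>
      \<Longrightarrow> (x, y, z, f, g, h) \<in> Tri C
        \<longleftrightarrow> (y, z, sh C x, g, h, \<ominus>\<^bsub>Mor C (sh C x) (sh C y)\<^esub> sh1 C f) \<in> Tri C"
    and tri_complete: "\<lbrakk>(x, y, z, f, g, h) \<in> Tri C; (x', y', z', f', g', h') \<in> Tri C;
        a \<in> arr C x x'; b \<in> arr C y y'; b \<cdot> f = f' \<cdot> a\<rbrakk>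
      \<Longrightarrow> \<exists>c\<in>arr C z z'. c \<cdot> g = g' \<cdot> b \<and> sh1 C a \<cdot> h = h' \<cdot> c"
    and tri_octahedral: "\<lbrakk>(x, y, z', f, u, u') \<in> Tri C; (y, z, x', g, v, v') \<in> Tri C;
        (x, z, y', g \<cdot> f, w, w') \<in> Tri C\<rbrakk>
      \<Longrightarrow> \<exists>a b. (z', y', x', a, b, sh1 C u \<cdot> v') \<in> Tri C
            \<and> a \<cdot> u = w \<cdot> g \<and> w' \<cdot> a = u'
            \<and> b \<cdot> w = v \<and> v' \<cdot> b = sh1 C f \<cdot> w'"

definition exact_functor ::
  "('o, 'm, 'z) tri_cat_scheme \<Rightarrow> ('p, 'q, 'y) tri_cat_scheme \<Rightarrow> ('o \<Rightarrow> 'p) \<Rightarrow> ('m \<Rightarrow> 'q) \<Rightarrow> bool" where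
  "exact_functor C D F F1 \<longleftrightarrow> linear_functor C D F F1
     \<and> (\<exists>\<phi>. (\<forall>x\<in>Ob C. iso_arr D (F (sh C x)) (sh D (F x)) (\<phi> x))
          \<and> (\<forall>x\<in>Ob C. \<forall>y\<in>Ob C. \<forall>f\<in>arr C x y.
               \<phi> y \<cdot>\<^bsub>D\<^esub> F1 (sh1 C f) = sh1 D (F1 f) \<cdot>\<^bsub>D\<^esub> \<phi> x)
          \<and> (\<forall>x y z f g h. (x, y, z, f, g, h) \<in> Tri C
               \<longrightarrow> (F x, F y, F z, F1 f, F1 g, \<phi> x \<cdot>\<^bsub>D\<^esub> F1 h) \<in> Tri D))"


section \<open>Triangulated 2-categories\<close>

text \<open>
  A strict 2-category with set of objects \<open>Cells\<close>. The object a is the triangulated category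
  \<open>Und a\<close>, and \<open>HomC a b\<close> is the category of 1-morphisms from a to b and 2-morphisms between
  them. A 1-morphism F is an exact functor, given by \<open>actO F\<close> on objects and \<open>actM F\<close> on
  morphisms, and a 2-morphism \<alpha> is a natural transformation with components \<open>actN \<alpha> x\<close>; neither
  is required to be determined by this underlying functor or natural transformation, since
  functors between triangulated categories do not form a triangulated category in general.
\<close>

record ('k, 'f, 'm, 'o, 'p) two_cat =
  Cells :: "'k set"
  HomC :: "'k \<Rightarrow> 'k \<Rightarrow> ('f, 'm) tri_cat"
  unit1 :: "'k \<Rightarrow> 'f"
  hc1 :: "'f \<Rightarrow> 'f \<Rightarrow> 'f" (infixl "\<bullet>\<index>" 75)
  hc2 :: "'m \<Rightarrow> 'm \<Rightarrow> 'm" (infixl "\<star>\<index>" 75)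
  Und :: "'k \<Rightarrow> ('o, 'p) tri_cat"
  actO :: "'f \<Rightarrow> 'o \<Rightarrow> 'o"
  actM :: "'f \<Rightarrow> 'p \<Rightarrow> 'p"
  actN :: "'m \<Rightarrow> 'o \<Rightarrow> 'p"

abbreviation mor1 :: "('k, 'f, 'm, 'o, 'p) two_cat \<Rightarrow> 'k \<Rightarrow> 'k \<Rightarrow> 'f set" where
  "mor1 K a b \<equiv> Ob (HomC K a b)"

abbreviation mor2 :: "('k, 'f, 'm, 'o, 'p) two_cat \<Rightarrow> 'k \<Rightarrow> 'k \<Rightarrow> 'f \<Rightarrow> 'f \<Rightarrow> 'm set" where
  "mor2 K a b F G \<equiv> arr (HomC K a b) F G"

locale triangulated_two_category =
  fixes K :: "('k, 'f, 'm, 'o, 'p) two_cat" (structure)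
  assumes hom_triangulated:
      "\<lbrakk>a \<in> Cells K; b \<in> Cells K\<rbrakk> \<Longrightarrow> triangulated_category (HomC K a b)"
    and hom_idempotent_complete:
      "\<lbrakk>a \<in> Cells K; b \<in> Cells K\<rbrakk> \<Longrightarrow> idempotent_complete (HomC K a b)"
    and unit1_in: "a \<in> Cells K \<Longrightarrow> unit1 K a \<in> mor1 K a a"
    and hc1_in: "\<lbrakk>a \<in> Cells K; b \<in> Cells K; c \<in> Cells K; F \<in> mor1 K a b; G \<in> mor1 K b c\<rbrakk>
      \<Longrightarrow> G \<bullet> F \<in> mor1 K a c"
    and hc1_assoc: "\<lbrakk>a \<in> Cells K; b \<in> Cells K; c \<in> Cells K; d \<in> Cells K;
        F \<in> mor1 K a b; G \<in> mor1 K b c; H \<in> mor1 K c d\<rbrakk>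
      \<Longrightarrow> (H \<bullet> G) \<bullet> F = H \<bullet> (G \<bullet> F)"
    and unit1_left: "\<lbrakk>a \<in> Cells K; b \<in> Cells K; F \<in> mor1 K a b\<rbrakk> \<Longrightarrow> unit1 K b \<bullet> F = F"
    and unit1_right: "\<lbrakk>a \<in> Cells K; b \<in> Cells K; F \<in> mor1 K a b\<rbrakk> \<Longrightarrow> F \<bullet> unit1 K a = F"
    and hc2_linear_right: "\<lbrakk>a \<in> Cells K; b \<in> Cells K; c \<in> Cells K;
        F \<in> mor1 K a b; F' \<in> mor1 K a b; G \<in> mor1 K b c; G' \<in> mor1 K b c; \<beta> \<in> mor2 K b c G G'\<rbrakk>
      \<Longrightarrow> linear_map (Mor (HomC K a b) F F') (Mor (HomC K a c) (G \<bullet> F) (G' \<bullet> F')) (\<lambda>\<alpha>. \<beta> \<star> \<alpha>)"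
    and hc2_linear_left: "\<lbrakk>a \<in> Cells K; b \<in> Cells K; c \<in> Cells K;
        F \<in> mor1 K a b; F' \<in> mor1 K a b; G \<in> mor1 K b c; G' \<in> mor1 K b c; \<alpha> \<in> mor2 K a b F F'\<rbrakk>
      \<Longrightarrow> linear_map (Mor (HomC K b c) G G') (Mor (HomC K a c) (G \<bullet> F) (G' \<bullet> F')) (\<lambda>\<beta>. \<beta> \<star> \<alpha>)"
    and hc2_ide: "\<lbrakk>a \<in> Cells K; b \<in> Cells K; c \<in> Cells K; F \<in> mor1 K a b; G \<in> mor1 K b c\<rbrakk>
      \<Longrightarrow> ide (HomC K b c) G \<star> ide (HomC K a b) F = ide (HomC K a c) (G \<bullet> F)"
    and interchange: "\<lbrakk>a \<in> Cells K; b \<in> Cells K; c \<in> Cells K;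
        F \<in> mor1 K a b; F' \<in> mor1 K a b; F'' \<in> mor1 K a b;
        G \<in> mor1 K b c; G' \<in> mor1 K b c; G'' \<in> mor1 K b c;
        \<alpha> \<in> mor2 K a b F F'; \<alpha>' \<in> mor2 K a b F' F'';
        \<beta> \<in> mor2 K b c G G'; \<beta>' \<in> mor2 K b c G' G''\<rbrakk>
      \<Longrightarrow> (\<beta>' \<cdot>\<^bsub>HomC K b c\<^esub> \<beta>) \<star> (\<alpha>' \<cdot>\<^bsub>HomC K a b\<^esub> \<alpha>)
          = (\<beta>' \<star> \<alpha>') \<cdot>\<^bsub>HomC K a c\<^esub> (\<beta> \<star> \<alpha>)"
    and hc2_assoc: "\<lbrakk>a \<in> Cells K; b \<in> Cells K; c \<in> Cells K; d \<in> Cells K;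
        F \<in> mor1 K a b; F' \<in> mor1 K a b; G \<in> mor1 K b c; G' \<in> mor1 K b c;
        H \<in> mor1 K c d; H' \<in> mor1 K c d;
        \<alpha> \<in> mor2 K a b F F'; \<beta> \<in> mor2 K b c G G'; \<gamma> \<in> mor2 K c d H H'\<rbrakk>
      \<Longrightarrow> (\<gamma> \<star> \<beta>) \<star> \<alpha> = \<gamma> \<star> (\<beta> \<star> \<alpha>)"
    and hc2_unit_left: "\<lbrakk>a \<in> Cells K; b \<in> Cells K; F \<in> mor1 K a b; F' \<in> mor1 K a b;
        \<alpha> \<in> mor2 K a b F F'\<rbrakk> \<Longrightarrow> ide (HomC K b b) (unit1 K b) \<star> \<alpha> = \<alpha>"
    and hc2_unit_right: "\<lbrakk>a \<in> Cells K; b \<in> Cells K; F \<in> mor1 K a b; F' \<in> mor1 K a b;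
        \<alpha> \<in> mor2 K a b F F'\<rbrakk> \<Longrightarrow> \<alpha> \<star> ide (HomC K a a) (unit1 K a) = \<alpha>"
    and exact_left: "\<lbrakk>a \<in> Cells K; b \<in> Cells K; c \<in> Cells K; G \<in> mor1 K b c\<rbrakk>
      \<Longrightarrow> exact_functor (HomC K a b) (HomC K a c) (\<lambda>F. G \<bullet> F) (\<lambda>\<alpha>. ide (HomC K b c) G \<star> \<alpha>)"
    and exact_right: "\<lbrakk>a \<in> Cells K; b \<in> Cells K; c \<in> Cells K; F \<in> mor1 K a b\<rbrakk>
      \<Longrightarrow> exact_functor (HomC K b c) (HomC K a c) (\<lambda>G. G \<bullet> F) (\<lambda>\<beta>. \<beta> \<star> ide (HomC K a b) F)"
    and und_triangulated: "a \<in> Cells K \<Longrightarrow> triangulated_category (Und K a)"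
    and act_functor: "\<lbrakk>a \<in> Cells K; b \<in> Cells K; F \<in> mor1 K a b\<rbrakk>
      \<Longrightarrow> exact_functor (Und K a) (Und K b) (actO K F) (actM K F)"
    and act_unit1: "\<lbrakk>a \<in> Cells K; x \<in> Ob (Und K a); y \<in> Ob (Und K a); f \<in> arr (Und K a) x y\<rbrakk>
      \<Longrightarrow> actO K (unit1 K a) x = x \<and> actM K (unit1 K a) f = f"
    and act_hc1: "\<lbrakk>a \<in> Cells K; b \<in> Cells K; c \<in> Cells K; F \<in> mor1 K a b; G \<in> mor1 K b c;
        x \<in> Ob (Und K a); y \<in> Ob (Und K a); f \<in> arr (Und K a) x y\<rbrakk>
      \<Longrightarrow> actO K (G \<bullet> F) x = actO K G (actO K F x) \<and> actM K (G \<bullet> F) f = actM K G (actM K F f)"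
    and act_linear: "\<lbrakk>a \<in> Cells K; b \<in> Cells K; F \<in> mor1 K a b; G \<in> mor1 K a b;
        x \<in> Ob (Und K a)\<rbrakk>
      \<Longrightarrow> linear_map (Mor (HomC K a b) F G) (Mor (Und K b) (actO K F x) (actO K G x))
            (\<lambda>\<alpha>. actN K \<alpha> x)"
    and act_natural: "\<lbrakk>a \<in> Cells K; b \<in> Cells K; F \<in> mor1 K a b; G \<in> mor1 K a b;
        \<alpha> \<in> mor2 K a b F G; x \<in> Ob (Und K a); y \<in> Ob (Und K a); f \<in> arr (Und K a) x y\<rbrakk>
      \<Longrightarrow> actN K \<alpha> y \<cdot>\<^bsub>Und K b\<^esub> actM K F f = actM K G f \<cdot>\<^bsub>Und K b\<^esub> actN K \<alpha> x"
    and act_ide: "\<lbrakk>a \<in> Cells K; b \<in> Cells K; F \<in> mor1 K a b; x \<in> Ob (Und K a)\<rbrakk>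
      \<Longrightarrow> actN K (ide (HomC K a b) F) x = ide (Und K b) (actO K F x)"
    and act_cmp: "\<lbrakk>a \<in> Cells K; b \<in> Cells K;
        F \<in> mor1 K a b; G \<in> mor1 K a b; H \<in> mor1 K a b;
        \<alpha> \<in> mor2 K a b F G; \<beta> \<in> mor2 K a b G H; x \<in> Ob (Und K a)\<rbrakk>
      \<Longrightarrow> actN K (\<beta> \<cdot>\<^bsub>HomC K a b\<^esub> \<alpha>) x = actN K \<beta> x \<cdot>\<^bsub>Und K b\<^esub> actN K \<alpha> x"
    and act_hc2: "\<lbrakk>a \<in> Cells K; b \<in> Cells K; c \<in> Cells K;
        F \<in> mor1 K a b; F' \<in> mor1 K a b; G \<in> mor1 K b c; G' \<in> mor1 K b c;
        \<alpha> \<in> mor2 K a b F F'; \<beta> \<in> mor2 K b c G G'; x \<in> Ob (Und K a)\<rbrakk>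
      \<Longrightarrow> actN K (\<beta> \<star> \<alpha>) x = actN K \<beta> (actO K F' x) \<cdot>\<^bsub>Und K c\<^esub> actM K G (actN K \<alpha> x)"

text \<open>L : a \<open>\<rightarrow>\<close> b is left adjoint to R : b \<open>\<rightarrow>\<close> a, with unit u and counit e.\<close>

definition adjoint_pair ::
  "('k, 'f, 'm, 'o, 'p) two_cat \<Rightarrow> 'k \<Rightarrow> 'k \<Rightarrow> 'f \<Rightarrow> 'f \<Rightarrow> bool" where
  "adjoint_pair K a b L R \<longleftrightarrow> L \<in> mor1 K a b \<and> R \<in> mor1 K b a
     \<and> (\<exists>u\<in>mor2 K a a (unit1 K a) (R \<bullet>\<^bsub>K\<^esub> L). \<exists>e\<in>mor2 K b b (L \<bullet>\<^bsub>K\<^esub> R) (unit1 K b).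
          (e \<star>\<^bsub>K\<^esub> ide (HomC K a b) L) \<cdot>\<^bsub>HomC K a b\<^esub> (ide (HomC K a b) L \<star>\<^bsub>K\<^esub> u)
            = ide (HomC K a b) L
          \<and> (ide (HomC K b a) R \<star>\<^bsub>K\<^esub> e) \<cdot>\<^bsub>HomC K b a\<^esub> (u \<star>\<^bsub>K\<^esub> ide (HomC K b a) R)
            = ide (HomC K b a) R)"


section \<open>Weights\<close>

text \<open>A weight in \<open>\<int>\<^sup>n\<close> is a function supported on the positions 1, ..., n.\<close>

type_synonym weight = "nat \<Rightarrow> int"

definition weights :: "nat \<Rightarrow> weight set" where
  "weights n = {k. \<forall>i. i \<notin> {1..n} \<longrightarrow> k i = 0}"

definition compositions :: "nat \<Rightarrow> nat \<Rightarrow> weight set" where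
  "compositions n N = {k \<in> weights n. (\<forall>i\<in>{1..n}. k i \<ge> 0) \<and> (\<Sum>i=1..n. k i) = int N}"

definition simple_root :: "nat \<Rightarrow> weight" where
  "simple_root i = (\<lambda>j. if j = i then -1 else if j = i + 1 then 1 else 0)"

definition highest_weight :: "nat \<Rightarrow> nat \<Rightarrow> weight" where
  "highest_weight n N = (\<lambda>j. if j = n then int N else 0)"


section \<open>Categorical actions\<close>

text \<open>
  \<open>E i r k\<close> is \<open>E\<^sub>i\<^sub>,\<^sub>r 1\<^sub>k\<close> from k to \<open>k - \<alpha>\<^sub>i\<close>, while \<open>EL i r k\<close> and \<open>ER i r k\<close> are the adjoints
  with source k, from k to \<open>k + \<alpha>\<^sub>i\<close>; hence they are the adjoints of \<open>E i r (k + \<alpha>\<^sub>i)\<close>.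
\<close>

locale categorical_Un_plus_action = triangulated_two_category K
  for n N :: nat
    and K :: "(weight, 'f, 'm, 'o, 'p) two_cat" (structure)
    and E EL ER :: "nat \<Rightarrow> int \<Rightarrow> weight \<Rightarrow> 'f" +
  assumes cells: "Cells K = weights n"
    and zero_category: "\<lbrakk>k \<in> weights n; k \<notin> compositions n N; x \<in> Ob (Und K k)\<rbrakk>
      \<Longrightarrow> zero_object (Und K k) x"
    and zero_mor1: "\<lbrakk>k \<in> weights n; l \<in> weights n; k \<notin> compositions n N \<or> l \<notin> compositions n N;
        F \<in> mor1 K k l\<rbrakk> \<Longrightarrow> zero_object (HomC K k l) F"
    and E_in: "\<lbrakk>k \<in> weights n; i \<in> {1..n-1}\<rbrakk> \<Longrightarrow> E i r k \<in> mor1 K k (k - simple_root i)"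
    and E_left_adjoint: "\<lbrakk>k \<in> weights n; i \<in> {1..n-1}\<rbrakk>
      \<Longrightarrow> adjoint_pair K (k - simple_root i) k (EL i r (k - simple_root i)) (E i r k)"
    and E_right_adjoint: "\<lbrakk>k \<in> weights n; i \<in> {1..n-1}\<rbrakk>
      \<Longrightarrow> adjoint_pair K k (k - simple_root i) (E i r k) (ER i r (k - simple_root i))"
    and EE_same_ge: "\<lbrakk>k \<in> weights n; i \<in> {1..n-1}; r - s \<ge> 0\<rbrakk>
      \<Longrightarrow> isomorphic (HomC K k (k - simple_root i - simple_root i))
            (E i r (k - simple_root i) \<bullet> E i s k)
            (sh (HomC K k (k - simple_root i - simple_root i))
              (E i (s - 1) (k - simple_root i) \<bullet> E i (r + 1) k))"
    and EE_same_zero: "\<lbrakk>k \<in> weights n; i \<in> {1..n-1}; r - s = -1\<rbrakk>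
      \<Longrightarrow> zero_object (HomC K k (k - simple_root i - simple_root i))
            (E i r (k - simple_root i) \<bullet> E i s k)"
    and EE_same_le: "\<lbrakk>k \<in> weights n; i \<in> {1..n-1}; r - s \<le> -2\<rbrakk>
      \<Longrightarrow> isomorphic (HomC K k (k - simple_root i - simple_root i))
            (E i r (k - simple_root i) \<bullet> E i s k)
            (unsh (HomC K k (k - simple_root i - simple_root i))
              (E i (s - 1) (k - simple_root i) \<bullet> E i (r + 1) k))"
    and EE_adjacent: "\<lbrakk>k \<in> weights n; i \<in> {1..n-1}; i + 1 \<in> {1..n-1}\<rbrakk>
      \<Longrightarrow> exact_triangle (HomC K k (k - simple_root i - simple_root (i + 1)))
            (E i (r + 1) (k - simple_root (i + 1)) \<bullet> E (i + 1) (s - 1) k)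
            (E i r (k - simple_root (i + 1)) \<bullet> E (i + 1) s k)
            (E (i + 1) s (k - simple_root i) \<bullet> E i r k)"
    and EE_distant: "\<lbrakk>k \<in> weights n; i \<in> {1..n-1}; j \<in> {1..n-1}; \<bar>int i - int j\<bar> \<ge> 2\<rbrakk>
      \<Longrightarrow> isomorphic (HomC K k (k - simple_root i - simple_root j))
            (E i r (k - simple_root j) \<bullet> E j s k)
            (E j s (k - simple_root i) \<bullet> E i r k)"
    and triangle_right: "\<lbrakk>k \<in> weights n; i \<in> {1..n-1}\<rbrakk>
      \<Longrightarrow> exact_triangle (HomC K k k)
            (E i r (k + simple_root i) \<bullet> ER i r k)
            (unit1 K k)
            (ER i (r - 1) (k - simple_root i) \<bullet> E i (r - 1) k)"
    and triangle_left: "\<lbrakk>k \<in> weights n; i \<in> {1..n-1}\<rbrakk>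
      \<Longrightarrow> exact_triangle (HomC K k k)
            (EL i (r - 1) (k - simple_root i) \<bullet> E i (r - 1) k)
            (unit1 K k)
            (E i r (k + simple_root i) \<bullet> EL i r k)"
    and ER_same: "\<lbrakk>k \<in> weights n; i \<in> {1..n-1}; 1 \<le> r - s; r - s \<le> k i + k (i + 1) - 1\<rbrakk>
      \<Longrightarrow> isomorphic (HomC K k k)
            (E i r (k + simple_root i) \<bullet> ER i s k)
            (unsh (HomC K k k) (ER i (s - 1) (k - simple_root i) \<bullet> E i (r - 1) k))"
    and EL_same: "\<lbrakk>k \<in> weights n; i \<in> {1..n-1}; - k i - k (i + 1) + 1 \<le> r - s; r - s \<le> -1\<rbrakk>
      \<Longrightarrow> isomorphic (HomC K k k)
            (E i r (k + simple_root i) \<bullet> EL i s k)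
            (sh (HomC K k k) (EL i (s - 1) (k - simple_root i) \<bullet> E i (r - 1) k))"
    and ER_next: "\<lbrakk>k \<in> weights n; i \<in> {1..n-1}; i + 1 \<in> {1..n-1}\<rbrakk>
      \<Longrightarrow> isomorphic (HomC K k (k - simple_root i + simple_root (i + 1)))
            (E i r (k + simple_root (i + 1)) \<bullet> ER (i + 1) s k)
            (sh (HomC K k (k - simple_root i + simple_root (i + 1)))
              (ER (i + 1) (s + 1) (k - simple_root i) \<bullet> E i (r + 1) k))"
    and ER_prev: "\<lbrakk>k \<in> weights n; i \<in> {1..n-1}; i - 1 \<in> {1..n-1}\<rbrakk>
      \<Longrightarrow> isomorphic (HomC K k (k - simple_root i + simple_root (i - 1)))
            (E i r (k + simple_root (i - 1)) \<bullet> ER (i - 1) s k)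
            (ER (i - 1) s (k - simple_root i) \<bullet> E i r k)"
    and EL_next: "\<lbrakk>k \<in> weights n; i \<in> {1..n-1}; i + 1 \<in> {1..n-1}\<rbrakk>
      \<Longrightarrow> isomorphic (HomC K k (k - simple_root i + simple_root (i + 1)))
            (E i r (k + simple_root (i + 1)) \<bullet> EL (i + 1) s k)
            (EL (i + 1) s (k - simple_root i) \<bullet> E i r k)"
    and EL_prev: "\<lbrakk>k \<in> weights n; i \<in> {1..n-1}; i - 1 \<in> {1..n-1}\<rbrakk>
      \<Longrightarrow> isomorphic (HomC K k (k - simple_root i + simple_root (i - 1)))
            (E i r (k + simple_root (i - 1)) \<bullet> EL (i - 1) s k)
            (unsh (HomC K k (k - simple_root i + simple_root (i - 1)))
              (EL (i - 1) (s + 1) (k - simple_root i) \<bullet> E i (r + 1) k))"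
    and ER_distant: "\<lbrakk>k \<in> weights n; i \<in> {1..n-1}; j \<in> {1..n-1}; \<bar>int i - int j\<bar> \<ge> 2\<rbrakk>
      \<Longrightarrow> isomorphic (HomC K k (k - simple_root i + simple_root j))
            (E i r (k + simple_root j) \<bullet> ER j s k)
            (ER j s (k - simple_root i) \<bullet> E i r k)"
    and EL_distant: "\<lbrakk>k \<in> weights n; i \<in> {1..n-1}; j \<in> {1..n-1}; \<bar>int i - int j\<bar> \<ge> 2\<rbrakk>
      \<Longrightarrow> isomorphic (HomC K k (k - simple_root i + simple_root j))
            (E i r (k + simple_root j) \<bullet> EL j s k)
            (EL j s (k - simple_root i) \<bullet> E i r k)"


section \<open>Young diagrams and the associated 1-morphisms\<close>

text \<open>A diagram in P(a, b) is the list of its b parts, padded with zeros; a and b are nonnegative.\<close>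

definition young_diagrams :: "int \<Rightarrow> int \<Rightarrow> int list set" where
  "young_diagrams a b =
     {\<mu>. int (length \<mu>) = b \<and> sorted_wrt (\<ge>) \<mu> \<and> (\<forall>x\<in>set \<mu>. 0 \<le> x \<and> x \<le> a)}"

definition lex_less :: "int list \<Rightarrow> int list \<Rightarrow> bool" where
  "lex_less \<mu> \<nu> \<longleftrightarrow> (\<exists>j < min (length \<mu>) (length \<nu>). (\<forall>i<j. \<mu> ! i = \<nu> ! i) \<and> \<mu> ! j < \<nu> ! j)"

definition diagram_tuple :: "nat \<Rightarrow> weight \<Rightarrow> (nat \<Rightarrow> int list) \<Rightarrow> bool" where
  "diagram_tuple n k \<mu> \<longleftrightarrow> (\<forall>i\<in>{1..n-1}. \<mu> i \<in> young_diagrams (k (i + 1)) (\<Sum>j=1..i. k j))"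

definition product_lex_less :: "nat \<Rightarrow> (nat \<Rightarrow> int list) \<Rightarrow> (nat \<Rightarrow> int list) \<Rightarrow> bool" where
  "product_lex_less n \<mu> \<nu> \<longleftrightarrow>
     (\<exists>i\<in>{1..n-1}. (\<forall>j\<in>{1..<i}. \<mu> j = \<nu> j) \<and> lex_less (\<mu> i) (\<nu> i))"

text \<open>
  For a word \<open>(i\<^sub>1, r\<^sub>1), ..., (i\<^sub>m, r\<^sub>m)\<close>, the 1-morphism \<open>E i\<^sub>1 r\<^sub>1 \<cdots> E i\<^sub>m r\<^sub>m\<close> with source k
  (the last letter is applied first), and its target weight.
\<close>

fun word_target :: "(nat \<times> int) list \<Rightarrow> weight \<Rightarrow> weight" where
  "word_target [] k = k"
| "word_target ((i, r) # w) k = word_target w k - simple_root i"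

fun E_word ::
  "(weight, 'f, 'm, 'o, 'p) two_cat \<Rightarrow> (nat \<Rightarrow> int \<Rightarrow> weight \<Rightarrow> 'f) \<Rightarrow> (nat \<times> int) list \<Rightarrow> weight \<Rightarrow> 'f" where
  "E_word K E [] k = unit1 K k"
| "E_word K E ((i, r) # w) k = E i r (word_target w k) \<bullet>\<^bsub>K\<^esub> E_word K E w k"

definition tuple_word :: "nat \<Rightarrow> (nat \<Rightarrow> int list) \<Rightarrow> (nat \<times> int) list" where
  "tuple_word n \<mu> = concat (map (\<lambda>i. map (\<lambda>r. (i, r)) (\<mu> i)) [1..<n])"

definition E_tuple ::
  "nat \<Rightarrow> (weight, 'f, 'm, 'o, 'p) two_cat \<Rightarrow> (nat \<Rightarrow> int \<Rightarrow> weight \<Rightarrow> 'f) \<Rightarrow> (nat \<Rightarrow> int list) \<Rightarrow> weight \<Rightarrow> 'f"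
  where "E_tuple n K E \<mu> k = E_word K E (tuple_word n \<mu>) k"

end

theory Submission
  imports Defs
begin

text \<open>
  Only left adjoints are needed. Moving \<open>E\<^sup>L\<^sub>i\<^sub>,\<^sub>s\<close> to the right through \<open>E\<^sub>i\<^sub>,\<^sub>\<lambda>\<close> with (4)(a) raises s by one
  at each step; if s exceeds all parts of \<open>\<lambda>\<close>, the box containing \<open>\<lambda>\<close> keeps every difference in the
  range of (4)(a), and the process ends with \<open>E\<^sup>L\<^sub>i\<close> applied at a weight whose i-th entry is 0, which
  is zero. Hence \<open>E\<^sup>L\<^sub>i\<^sub>,\<^sub>s E\<^sub>i\<^sub>,\<^sub>\<lambda> \<cdots> 1\<^sub>\<eta> = 0\<close> for \<open>s > \<lambda>\<^sub>1\<close>. By adjunction, morphisms vanish when the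
  first parts are r < s. For \<open>s = r + 1\<close> and \<open>r \<ge> \<lambda>\<^sub>1\<close> the triangle (3) gives \<open>E\<^sup>L\<^sub>i\<^sub>,\<^sub>r E\<^sub>i\<^sub>,\<^sub>r P \<cong> P\<close> for the
  1-morphism \<open>P = E\<^sub>i\<^sub>,\<^sub>\<lambda> \<cdots> 1\<^sub>\<eta>\<close>, so that equal first parts can be cancelled. The triangle does not
  say that this isomorphism is the counit; that the counit is invertible follows because the
  endomorphisms of P commute, being those of \<open>1\<^sub>\<eta>\<close> by induction.
\<close>

section \<open>Linear categories and cones\<close>

lemma linear_map_closed: "linear_map V W \<phi> \<Longrightarrow> v \<in> carrier V \<Longrightarrow> \<phi> v \<in> carrier W"
  by (auto simp: linear_map_def)

lemma linear_map_zero: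
  assumes "module complex_ring V" "module complex_ring W" "linear_map V W \<phi>"
  shows "\<phi> \<zero>\<^bsub>V\<^esub> = \<zero>\<^bsub>W\<^esub>"
proof -
  interpret V: module complex_ring V by fact
  interpret W: module complex_ring W by fact
  have z: "\<zero>\<^bsub>V\<^esub> \<in> carrier V" by simp
  then have "\<phi> (\<zero>\<^bsub>complex_ring\<^esub> \<odot>\<^bsub>V\<^esub> \<zero>\<^bsub>V\<^esub>) = \<zero>\<^bsub>complex_ring\<^esub> \<odot>\<^bsub>W\<^esub> \<phi> \<zero>\<^bsub>V\<^esub>"
    using assms(3) unfolding linear_map_def by blast
  then show ?thesis
    using V.smult_l_null[OF z] W.smult_l_null linear_map_closed[OF assms(3) z] by simp
qed

lemma linear_map_neg:
  assumes "module complex_ring V" "module complex_ring W" "linear_map V W \<phi>" "v \<in> carrier V"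
  shows "\<phi> (\<ominus>\<^bsub>V\<^esub> v) = \<ominus>\<^bsub>W\<^esub> \<phi> v"
proof -
  interpret V: module complex_ring V by fact
  interpret W: module complex_ring W by fact
  have nv: "\<ominus>\<^bsub>V\<^esub> v \<in> carrier V" using assms(4) by simp
  have "\<phi> (\<ominus>\<^bsub>V\<^esub> v) \<oplus>\<^bsub>W\<^esub> \<phi> v = \<phi> (\<ominus>\<^bsub>V\<^esub> v \<oplus>\<^bsub>V\<^esub> v)"
    using assms(3,4) nv unfolding linear_map_def by metis
  also have "\<dots> = \<zero>\<^bsub>W\<^esub>"
    using linear_map_zero[OF assms(1-3)] assms(4) by (simp add: V.l_neg)
  finally show ?thesis
    using W.minus_equality linear_map_closed[OF assms(3)] assms(4) nv by metis
qed

context lin_category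
begin

lemma cmp_closed:
  "\<lbrakk>x \<in> Ob C; y \<in> Ob C; z \<in> Ob C; f \<in> arr C x y; g \<in> arr C y z\<rbrakk> \<Longrightarrow> g \<cdot> f \<in> arr C x z"
  using linear_post linear_map_closed by fastforce

lemma zero_closed: "\<lbrakk>x \<in> Ob C; y \<in> Ob C\<rbrakk> \<Longrightarrow> \<zero>\<^bsub>Mor C x y\<^esub> \<in> arr C x y"
  using hom_space module.axioms(2) abelian_group.axioms(1) abelian_monoid.zero_closed by metis

lemma neg_closed: "\<lbrakk>x \<in> Ob C; y \<in> Ob C; f \<in> arr C x y\<rbrakk> \<Longrightarrow> \<ominus>\<^bsub>Mor C x y\<^esub> f \<in> arr C x y"
  using hom_space module.axioms(2) abelian_group.a_inv_closed by metis

lemma neg_inject: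
  "\<lbrakk>x \<in> Ob C; y \<in> Ob C; f \<in> arr C x y; g \<in> arr C x y; \<ominus>\<^bsub>Mor C x y\<^esub> f = \<ominus>\<^bsub>Mor C x y\<^esub> g\<rbrakk> \<Longrightarrow> f = g"
  using hom_space module.axioms(2) abelian_group.minus_minus by metis

lemma cmp_zero_right:
  "\<lbrakk>x \<in> Ob C; y \<in> Ob C; z \<in> Ob C; g \<in> arr C y z\<rbrakk> \<Longrightarrow> g \<cdot> \<zero>\<^bsub>Mor C x y\<^esub> = \<zero>\<^bsub>Mor C x z\<^esub>"
  using linear_map_zero[OF hom_space hom_space linear_post] by blast

lemma cmp_zero_left:
  "\<lbrakk>x \<in> Ob C; y \<in> Ob C; z \<in> Ob C; f \<in> arr C x y\<rbrakk> \<Longrightarrow> \<zero>\<^bsub>Mor C y z\<^esub> \<cdot> f = \<zero>\<^bsub>Mor C x z\<^esub>"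
  using linear_map_zero[OF hom_space hom_space linear_pre] by blast

lemma cmp_neg_right:
  "\<lbrakk>x \<in> Ob C; y \<in> Ob C; z \<in> Ob C; f \<in> arr C x y; g \<in> arr C y z\<rbrakk>
    \<Longrightarrow> g \<cdot> (\<ominus>\<^bsub>Mor C x y\<^esub> f) = \<ominus>\<^bsub>Mor C x z\<^esub> (g \<cdot> f)"
  using linear_map_neg[OF hom_space hom_space linear_post] by blast

lemma cmp_neg_left:
  "\<lbrakk>x \<in> Ob C; y \<in> Ob C; z \<in> Ob C; f \<in> arr C x y; g \<in> arr C y z\<rbrakk>
    \<Longrightarrow> (\<ominus>\<^bsub>Mor C y z\<^esub> g) \<cdot> f = \<ominus>\<^bsub>Mor C x z\<^esub> (g \<cdot> f)"
  using linear_map_neg[OF hom_space hom_space linear_pre] by blast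

text \<open>Composing any arrow with a zero identity gives zero. The criterion is a single equation
  between endomorphisms, which linear functors preserve and faithful ones reflect.\<close>

lemma zero_object_iff: "zero_object C z \<longleftrightarrow> z \<in> Ob C \<and> ide C z = \<zero>\<^bsub>Mor C z z\<^esub>"
proof
  assume "zero_object C z"
  then show "z \<in> Ob C \<and> ide C z = \<zero>\<^bsub>Mor C z z\<^esub>"
    using ide_in unfolding zero_object_def by blast
next
  assume z: "z \<in> Ob C \<and> ide C z = \<zero>\<^bsub>Mor C z z\<^esub>"
  have "f = \<zero>\<^bsub>Mor C x z\<^esub>" if "x \<in> Ob C" "f \<in> arr C x z" for x f
    using ide_left[of x z f] cmp_zero_left[of x z z f] that z by simp
  moreover have "f = \<zero>\<^bsub>Mor C z x\<^esub>" if "x \<in> Ob C" "f \<in> arr C z x" for x f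
    using ide_right[of z x f] cmp_zero_right[of z z x f] that z by simp
  ultimately show "zero_object C z"
    unfolding zero_object_def using z zero_closed by blast
qed

lemma zero_object_isomorphic:
  assumes "isomorphic C x y" "zero_object C x" "y \<in> Ob C"
  shows "zero_object C y"
proof -
  obtain f g where "f \<in> arr C x y" "g \<in> arr C y x" "f \<cdot> g = ide C y"
    using assms(1) unfolding isomorphic_def iso_arr_def by blast
  moreover have "f = \<zero>\<^bsub>Mor C x y\<^esub>"
    using assms \<open>f \<in> arr C x y\<close> unfolding zero_object_def by blast
  ultimately show ?thesis
    using cmp_zero_left assms zero_object_iff by metis
qed

end

section \<open>Linear functors: zero arrows, zero objects, isomorphisms\<close>

lemma linear_functor_ob: "linear_functor C D F F1 \<Longrightarrow> x \<in> Ob C \<Longrightarrow> F x \<in> Ob D"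
  by (auto simp: linear_functor_def)

lemma linear_functor_map:
  "\<lbrakk>linear_functor C D F F1; x \<in> Ob C; y \<in> Ob C\<rbrakk> \<Longrightarrow> linear_map (Mor C x y) (Mor D (F x) (F y)) F1"
  by (auto simp: linear_functor_def)

lemma linear_functor_arr:
  "\<lbrakk>linear_functor C D F F1; x \<in> Ob C; y \<in> Ob C; f \<in> arr C x y\<rbrakk> \<Longrightarrow> F1 f \<in> arr D (F x) (F y)"
  using linear_functor_map linear_map_closed by metis

lemma linear_functor_ide: "linear_functor C D F F1 \<Longrightarrow> x \<in> Ob C \<Longrightarrow> F1 (ide C x) = ide D (F x)"
  by (auto simp: linear_functor_def)

lemma linear_functor_cmp:
  "\<lbrakk>linear_functor C D F F1; x \<in> Ob C; y \<in> Ob C; z \<in> Ob C; f \<in> arr C x y; g \<in> arr C y z\<rbrakk>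
    \<Longrightarrow> F1 (g \<cdot>\<^bsub>C\<^esub> f) = F1 g \<cdot>\<^bsub>D\<^esub> F1 f"
  unfolding linear_functor_def by blast

lemma linear_functor_zero:
  assumes "lin_category C" "lin_category D" "linear_functor C D F F1" "x \<in> Ob C" "y \<in> Ob C"
  shows "F1 \<zero>\<^bsub>Mor C x y\<^esub> = \<zero>\<^bsub>Mor D (F x) (F y)\<^esub>"
  using assms linear_map_zero[OF _ _ linear_functor_map] lin_category.hom_space linear_functor_ob
  by metis

lemma linear_functor_zero_object:
  assumes "lin_category C" "lin_category D" "linear_functor C D F F1" "zero_object C x"
  shows "zero_object D (F x)"
proof -
  have x: "x \<in> Ob C" and i: "ide C x = \<zero>\<^bsub>Mor C x x\<^esub>"
    using assms(4) lin_category.zero_object_iff[OF assms(1)] by auto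
  have "ide D (F x) = \<zero>\<^bsub>Mor D (F x) (F x)\<^esub>"
    using linear_functor_ide[OF assms(3) x] linear_functor_zero[OF assms(1-3) x x] i by simp
  then show ?thesis
    using lin_category.zero_object_iff[OF assms(2)] linear_functor_ob[OF assms(3) x] by simp
qed

lemma linear_functor_iso_arr:
  assumes F: "linear_functor C D F F1" and x: "x \<in> Ob C" and y: "y \<in> Ob C" and f: "iso_arr C x y f"
  shows "iso_arr D (F x) (F y) (F1 f)"
proof -
  obtain g where "f \<in> arr C x y" "g \<in> arr C y x" "g \<cdot>\<^bsub>C\<^esub> f = ide C x" "f \<cdot>\<^bsub>C\<^esub> g = ide C y"
    using f unfolding iso_arr_def by blast
  then show ?thesis
    unfolding iso_arr_def
    using linear_functor_arr[OF F] linear_functor_cmp[OF F] linear_functor_ide[OF F] x y by metis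
qed

section \<open>Zero objects and cones in triangulated categories\<close>

context triangulated_category
begin

lemma lin_category: "lin_category C" ..

lemma shift_ob: "x \<in> Ob C \<Longrightarrow> sh C x \<in> Ob C"
  using linear_functor_ob[OF shift_functor] .

lemma shift_arr: "\<lbrakk>x \<in> Ob C; y \<in> Ob C; f \<in> arr C x y\<rbrakk> \<Longrightarrow> sh1 C f \<in> arr C (sh C x) (sh C y)"
  using linear_functor_arr[OF shift_functor] .

lemma shift_ide: "x \<in> Ob C \<Longrightarrow> sh1 C (ide C x) = ide C (sh C x)"
  using linear_functor_ide[OF shift_functor] .

lemma shift_faithful:
  "\<lbrakk>x \<in> Ob C; y \<in> Ob C; f \<in> arr C x y; g \<in> arr C x y; sh1 C f = sh1 C g\<rbrakk> \<Longrightarrow> f = g"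
  using shift_fully_faithful unfolding fully_faithful_def by (metis bij_betw_def inj_onD)

lemma shift_full:
  "\<lbrakk>x \<in> Ob C; y \<in> Ob C; h \<in> arr C (sh C x) (sh C y)\<rbrakk> \<Longrightarrow> \<exists>f\<in>arr C x y. h = sh1 C f"
  using shift_fully_faithful unfolding fully_faithful_def by (metis bij_betw_def imageE)

text \<open>The shift is faithful, and the identity and the zero endomorphism of \<open>x\<close>
  become equal after applying it.\<close>

lemma zero_object_shift: "x \<in> Ob C \<Longrightarrow> zero_object C (sh C x) \<Longrightarrow> zero_object C x"
  using zero_object_iff shift_ide linear_functor_zero[OF lin_category lin_category shift_functor]
    shift_faithful ide_in zero_closed by metis

text \<open>
  A one-sided inverse of f after one shift comes from comparing rotations of the given triangle
  with rotations of the triangle of an identity.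
\<close>

lemma triangle_zero_cone_iso:
  assumes T: "(x, y, z, f, g, h) \<in> Tri C" and z: "zero_object C z"
  shows "iso_arr C x y f"
proof -
  have ob: "x \<in> Ob C" "y \<in> Ob C" "z \<in> Ob C"
    and f: "f \<in> arr C x y" and g: "g \<in> arr C y z" and h: "h \<in> arr C z (sh C x)"
    using tri_typed[OF T] by auto
  note sob = shift_ob[OF ob(1)] shift_ob[OF ob(2)] shift_ob[OF ob(3)]
  have into: "a = \<zero>\<^bsub>Mor C v z\<^esub>" if "v \<in> Ob C" "a \<in> arr C v z" for v a
    using z that unfolding zero_object_def by blast
  have outof: "a = \<zero>\<^bsub>Mor C z v\<^esub>" if "v \<in> Ob C" "a \<in> arr C z v" for v a
    using z that unfolding zero_object_def by blast
  \<comment> \<open>The identity triangle of \<open>v\<close>, rotated once. Any zero object may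
    serve as its third vertex, so \<open>z\<close> itself is taken.\<close>
  have rot: "(v, z, sh C v, \<zero>\<^bsub>Mor C v z\<^esub>, \<zero>\<^bsub>Mor C z (sh C v)\<^esub>,
      \<ominus>\<^bsub>Mor C (sh C v) (sh C v)\<^esub> ide C (sh C v)) \<in> Tri C" if "v \<in> Ob C" for v
    using tri_rotate[of v v z] tri_identity[OF that z] that ob ide_in zero_closed shift_ob shift_ide
    by metis
  have sf: "sh1 C f \<in> arr C (sh C x) (sh C y)" using shift_arr ob f by blast
  let ?mf = "\<ominus>\<^bsub>Mor C (sh C x) (sh C y)\<^esub> sh1 C f"
  have mf: "?mf \<in> arr C (sh C x) (sh C y)" using neg_closed sob sf by blast
  have T1: "(y, z, sh C x, g, h, ?mf) \<in> Tri C"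
    using tri_rotate[OF ob f g h] T by blast
  have T2: "(z, sh C x, sh C y, h, ?mf, \<ominus>\<^bsub>Mor C (sh C y) (sh C z)\<^esub> sh1 C g) \<in> Tri C"
    using tri_rotate[OF ob(2,3) sob(1) g h mf] T1 by blast
  \<comment> \<open>A map from the rotated identity triangle of \<open>y\<close> to
    \<open>T1\<close>, with \<open>ide C y\<close> and zero as given components. In the last square
    the two signs cancel, and \<open>c\<close> is a right inverse of the shifted
    \<open>f\<close>.\<close>
  have "\<exists>c\<in>arr C (sh C y) (sh C x). c \<cdot> \<zero>\<^bsub>Mor C z (sh C y)\<^esub> = h \<cdot> \<zero>\<^bsub>Mor C z z\<^esub>
      \<and> sh1 C (ide C y) \<cdot> (\<ominus>\<^bsub>Mor C (sh C y) (sh C y)\<^esub> ide C (sh C y)) = ?mf \<cdot> c"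
    by (rule tri_complete[OF rot[OF ob(2)] T1])
      (use ob into ide_in ide_right zero_closed cmp_zero_left g in \<open>metis+\<close>)
  then obtain c where c: "c \<in> arr C (sh C y) (sh C x)"
    and c2: "sh1 C (ide C y) \<cdot> (\<ominus>\<^bsub>Mor C (sh C y) (sh C y)\<^esub> ide C (sh C y)) = ?mf \<cdot> c"
    by blast
  have "\<ominus>\<^bsub>Mor C (sh C y) (sh C y)\<^esub> ide C (sh C y) = ?mf \<cdot> c"
    using c2 shift_ide ob ide_left neg_closed sob ide_in by metis
  then have e1: "sh1 C f \<cdot> c = ide C (sh C y)"
    using cmp_neg_left[OF sob(2,1,2) c sf] neg_inject cmp_closed[OF sob(2,1,2) c sf] sob ide_in
    by metis
  \<comment> \<open>Fullness of the shift produces \<open>s\<close>; faithfulness removes the shift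
    from the equation.\<close>
  obtain s where s: "s \<in> arr C y x" "c = sh1 C s" using shift_full ob c by blast
  have fs: "f \<cdot> s = ide C y"
    using e1 s linear_functor_cmp[OF shift_functor ob(2,1,2) s(1) f] shift_ide
      shift_faithful[OF ob(2,2)] cmp_closed[OF ob(2,1,2) s(1) f] ide_in ob by metis
  let ?mi = "\<ominus>\<^bsub>Mor C (sh C x) (sh C x)\<^esub> ide C (sh C x)"
  have mi: "?mi \<in> arr C (sh C x) (sh C x)" using neg_closed sob ide_in by blast
  have T3: "(z, sh C x, sh C x, \<zero>\<^bsub>Mor C z (sh C x)\<^esub>, ?mi,
      \<ominus>\<^bsub>Mor C (sh C x) (sh C z)\<^esub> sh1 C \<zero>\<^bsub>Mor C x z\<^esub>) \<in> Tri C"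
    using tri_rotate[OF ob(1,3) sob(1) zero_closed[OF ob(1,3)] zero_closed[OF ob(3) sob(1)] mi]
      rot[OF ob(1)] by blast
  \<comment> \<open>Conversely, \<open>T2\<close> is mapped to the identity triangle of
    \<open>x\<close> rotated twice, with identities as given components. The first square commutes
    because \<open>h\<close> starts at a zero object; \<open>d\<close> becomes a left inverse of the
    shifted \<open>f\<close>.\<close>
  have "\<exists>d\<in>arr C (sh C y) (sh C x). d \<cdot> ?mf = ?mi \<cdot> ide C (sh C x)
      \<and> sh1 C (ide C z) \<cdot> (\<ominus>\<^bsub>Mor C (sh C y) (sh C z)\<^esub> sh1 C g)
        = (\<ominus>\<^bsub>Mor C (sh C x) (sh C z)\<^esub> sh1 C \<zero>\<^bsub>Mor C x z\<^esub>) \<cdot> d"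
    by (rule tri_complete[OF T2 T3])
      (use ob sob outof[OF sob(1)] ide_in ide_left ide_right zero_closed h in \<open>metis+\<close>)
  then obtain d where d: "d \<in> arr C (sh C y) (sh C x)" and d2: "d \<cdot> ?mf = ?mi \<cdot> ide C (sh C x)"
    by blast
  have "d \<cdot> ?mf = ?mi" using d2 ide_right[OF sob(1,1) mi] by simp
  then have e2: "d \<cdot> sh1 C f = ide C (sh C x)"
    using cmp_neg_right[OF sob(1,2,1) sf d] neg_inject cmp_closed[OF sob(1,2,1) sf d] sob ide_in
    by metis
  obtain t where t: "t \<in> arr C y x" "d = sh1 C t" using shift_full ob d by blast
  have tf: "t \<cdot> f = ide C x"
    using e2 t linear_functor_cmp[OF shift_functor ob(1,2,1) f t(1)] shift_ide
      shift_faithful[OF ob(1,1)] cmp_closed[OF ob(1,2,1) f t(1)] ide_in ob by metis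
  have "t = s"
    using cmp_assoc[OF ob(2,1,2,1) s(1) f t(1)] tf fs ide_left[OF ob(2,1) s(1)]
      ide_right[OF ob(2,1) t(1)] by simp
  then show ?thesis unfolding iso_arr_def using f s tf fs by blast
qed

end

section \<open>Invertibility of the counit\<close>

text \<open>Unit, counit and triangle identities are kept abstract because the setting occurs twice:
  for composition with an adjoint pair on categories of 1-morphisms, and for the underlying functors
  of that pair.\<close>

locale linear_adjunction =
  C: lin_category C + D: lin_category D
  for C :: "('o, 'm, 'z) lin_cat_scheme" and D :: "('p, 'q, 'y) lin_cat_scheme" +
  fixes L :: "'o \<Rightarrow> 'p" and L1 :: "'m \<Rightarrow> 'q" and R :: "'p \<Rightarrow> 'o" and R1 :: "'q \<Rightarrow> 'm"
    and \<eta> :: "'o \<Rightarrow> 'm" and \<epsilon> :: "'p \<Rightarrow> 'q"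
  assumes L: "linear_functor C D L L1" and R: "linear_functor D C R R1"
    and unit_in: "x \<in> Ob C \<Longrightarrow> \<eta> x \<in> arr C x (R (L x))"
    and counit_in: "y \<in> Ob D \<Longrightarrow> \<epsilon> y \<in> arr D (L (R y)) y"
    and unit_nat: "\<lbrakk>x \<in> Ob C; x' \<in> Ob C; f \<in> arr C x x'\<rbrakk>
      \<Longrightarrow> \<eta> x' \<cdot>\<^bsub>C\<^esub> f = R1 (L1 f) \<cdot>\<^bsub>C\<^esub> \<eta> x"
    and counit_nat: "\<lbrakk>y \<in> Ob D; y' \<in> Ob D; g \<in> arr D y y'\<rbrakk>
      \<Longrightarrow> \<epsilon> y' \<cdot>\<^bsub>D\<^esub> L1 (R1 g) = g \<cdot>\<^bsub>D\<^esub> \<epsilon> y"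
    and triangle_L: "x \<in> Ob C \<Longrightarrow> \<epsilon> (L x) \<cdot>\<^bsub>D\<^esub> L1 (\<eta> x) = ide D (L x)"
    and triangle_R: "y \<in> Ob D \<Longrightarrow> R1 (\<epsilon> y) \<cdot>\<^bsub>C\<^esub> \<eta> (R y) = ide C (R y)"
begin

lemmas functor_simps =
  linear_functor_ob[OF L] linear_functor_ob[OF R] linear_functor_arr[OF L] linear_functor_arr[OF R]

text \<open>By the triangle identity \<open>f\<close> is recovered from \<open>L1 f\<close>, which
  vanishes since it starts at the zero object \<open>L x\<close>.\<close>

lemma hom_eq_zero:
  assumes x: "x \<in> Ob C" and y: "y \<in> Ob D" and z: "zero_object D (L x)"
  shows "arr C x (R y) = {\<zero>\<^bsub>Mor C x (R y)\<^esub>}"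
proof -
  have Lx: "L x \<in> Ob D" and Ry: "R y \<in> Ob C" using x y functor_simps by auto
  have "f = \<zero>\<^bsub>Mor C x (R y)\<^esub>" if f: "f \<in> arr C x (R y)" for f
  proof -
    have Lf: "L1 f = \<zero>\<^bsub>Mor D (L x) (L (R y))\<^esub>"
      using z functor_simps(1,3) x Ry f unfolding zero_object_def by blast
    have "R1 (L1 f) = \<zero>\<^bsub>Mor C (R (L x)) (R (L (R y)))\<^esub>"
      unfolding Lf using linear_functor_zero[OF D.lin_category_axioms C.lin_category_axioms R]
      Lx functor_simps(1)[OF Ry] by blast
    then have 1: "\<eta> (R y) \<cdot>\<^bsub>C\<^esub> f = \<zero>\<^bsub>Mor C x (R (L (R y)))\<^esub>"
      using unit_nat[OF x Ry f] C.cmp_zero_left unit_in x functor_simps Lx Ry by metis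
    have "f = (R1 (\<epsilon> y) \<cdot>\<^bsub>C\<^esub> \<eta> (R y)) \<cdot>\<^bsub>C\<^esub> f"
      using triangle_R[OF y] C.ide_left x Ry f by simp
    also have "\<dots> = R1 (\<epsilon> y) \<cdot>\<^bsub>C\<^esub> (\<eta> (R y) \<cdot>\<^bsub>C\<^esub> f)"
      by (rule C.cmp_assoc[OF x Ry _ Ry f]) (use functor_simps Ry y unit_in counit_in in auto)
    also have "\<dots> = \<zero>\<^bsub>Mor C x (R y)\<^esub>"
      unfolding 1 by (rule C.cmp_zero_right) (use functor_simps Ry y x counit_in in auto)
    finally show ?thesis .
  qed
  then show ?thesis using C.zero_closed[OF x Ry] by blast
qed

text \<open>This is the criterion for a right adjoint to be fully faithful, localised at the source:
  the counit is invertible at \<open>y\<close> alone, while \<open>y'\<close> is arbitrary. The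
  inverse map sends \<open>g\<close> to its adjunct precomposed with the inverse counit.\<close>

lemma hom_bij:
  assumes y: "y \<in> Ob D" and y': "y' \<in> Ob D"
    and iso: "iso_arr D (L (R y)) y (\<epsilon> y)"
  shows "bij_betw R1 (arr D y y') (arr C (R y) (R y'))"
proof -
  have Ry: "R y \<in> Ob C" "R y' \<in> Ob C" and LRy: "L (R y) \<in> Ob D" "L (R y') \<in> Ob D"
    using y y' functor_simps by auto
  have e: "\<epsilon> y \<in> arr D (L (R y)) y" "\<epsilon> y' \<in> arr D (L (R y')) y'" using counit_in y y' by auto
  obtain i where i: "i \<in> arr D y (L (R y))" "i \<cdot>\<^bsub>D\<^esub> \<epsilon> y = ide D (L (R y))"
    "\<epsilon> y \<cdot>\<^bsub>D\<^esub> i = ide D y"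
    using iso unfolding iso_arr_def by blast
  have RLR: "R (L (R y)) \<in> Ob C" "R (L (R y')) \<in> Ob C" using functor_simps LRy by auto
  have Re: "R1 (\<epsilon> y) \<in> arr C (R (L (R y))) (R y)" "R1 (\<epsilon> y') \<in> arr C (R (L (R y'))) (R y')"
    and Ri: "R1 i \<in> arr C (R y) (R (L (R y)))"
    using functor_simps e i y y' LRy by auto
  \<comment> \<open>The triangle identity at \<open>y\<close> forces the image of the inverse counit
    \<open>i\<close> under \<open>R1\<close> to be the unit at \<open>R y\<close>; surjectivity
    below rests on this.\<close>
  have "R1 i = R1 i \<cdot>\<^bsub>C\<^esub> (R1 (\<epsilon> y) \<cdot>\<^bsub>C\<^esub> \<eta> (R y))"
    using triangle_R[OF y] C.ide_right Ry RLR Ri by simp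
  also have "\<dots> = (R1 i \<cdot>\<^bsub>C\<^esub> R1 (\<epsilon> y)) \<cdot>\<^bsub>C\<^esub> \<eta> (R y)"
    by (rule C.cmp_assoc[symmetric, OF Ry(1) RLR(1) Ry(1) RLR(1) unit_in[OF Ry(1)] Re(1) Ri])
  also have "R1 i \<cdot>\<^bsub>C\<^esub> R1 (\<epsilon> y) = ide C (R (L (R y)))"
    using linear_functor_cmp[OF R LRy(1) y LRy(1) e(1) i(1)] i(2) linear_functor_ide[OF R LRy(1)]
    by simp
  finally have Ri_eq: "R1 i = \<eta> (R y)"
    using C.ide_left Ry RLR unit_in by simp
  show ?thesis
  proof (rule bij_betwI')
    fix f g assume f: "f \<in> arr D y y'" and g: "g \<in> arr D y y'"
    \<comment> \<open>Naturality of the counit expresses \<open>f\<close> through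
      \<open>R1 f\<close>, so \<open>R1\<close> is injective.\<close>
    have rec: "f = (\<epsilon> y' \<cdot>\<^bsub>D\<^esub> L1 (R1 f)) \<cdot>\<^bsub>D\<^esub> i" if f: "f \<in> arr D y y'" for f
      using counit_nat[OF y y' f] D.cmp_assoc[OF y LRy(1) y y' i(1) e(1) f] i(3)
        D.ide_right[OF y y' f] by simp
    show "(R1 f = R1 g) = (f = g)" using rec[OF f] rec[OF g] by metis
  next
    fix f assume "f \<in> arr D y y'"
    then show "R1 f \<in> arr C (R y) (R y')" using functor_simps y y' by blast
  next
    fix g assume g: "g \<in> arr C (R y) (R y')"
    have Lg: "L1 g \<in> arr D (L (R y)) (L (R y'))" using functor_simps Ry g by blast
    have RLg: "R1 (L1 g) \<in> arr C (R (L (R y))) (R (L (R y')))" using functor_simps LRy Lg by blast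
    have eLg: "\<epsilon> y' \<cdot>\<^bsub>D\<^esub> L1 g \<in> arr D (L (R y)) y'" using D.cmp_closed LRy y' Lg e by blast
    have "R1 ((\<epsilon> y' \<cdot>\<^bsub>D\<^esub> L1 g) \<cdot>\<^bsub>D\<^esub> i) = (R1 (\<epsilon> y') \<cdot>\<^bsub>C\<^esub> R1 (L1 g)) \<cdot>\<^bsub>C\<^esub> \<eta> (R y)"
      using linear_functor_cmp[OF R y LRy(1) y' i(1) eLg]
        linear_functor_cmp[OF R LRy y' Lg e(2)] Ri_eq by simp
    also have "\<dots> = R1 (\<epsilon> y') \<cdot>\<^bsub>C\<^esub> (\<eta> (R y') \<cdot>\<^bsub>C\<^esub> g)"
      using C.cmp_assoc[OF Ry(1) RLR Ry(2) unit_in[OF Ry(1)] RLg Re(2)] unit_nat[OF Ry g] by simp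
    also have "\<dots> = g"
      using C.cmp_assoc[OF Ry RLR(2) Ry(2) g unit_in[OF Ry(2)] Re(2)] triangle_R[OF y']
        C.ide_left[OF Ry g] by simp
    finally show "\<exists>f\<in>arr D y y'. g = R1 f"
      using D.cmp_closed[OF y LRy(1) y' i(1) eLg] by metis
  qed
qed

text \<open>
  Transporting the comultiplication along an arbitrary isomorphism \<open>L (R y) \<cong> y\<close> gives a right
  inverse b of the transported counit a, and commutativity makes it a left inverse.
\<close>

lemma counit_iso:
  assumes y: "y \<in> Ob D" and iso: "isomorphic D (L (R y)) y"
    and comm: "\<And>a b. \<lbrakk>a \<in> arr D y y; b \<in> arr D y y\<rbrakk> \<Longrightarrow> a \<cdot>\<^bsub>D\<^esub> b = b \<cdot>\<^bsub>D\<^esub> a"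
  shows "iso_arr D (L (R y)) y (\<epsilon> y)"
proof -
  let ?T = "L (R y)"
  obtain p q where p: "p \<in> arr D ?T y" and q: "q \<in> arr D y ?T"
    and qp: "q \<cdot>\<^bsub>D\<^esub> p = ide D ?T" and pq: "p \<cdot>\<^bsub>D\<^esub> q = ide D y"
    using iso unfolding isomorphic_def iso_arr_def by blast
  have Ry: "R y \<in> Ob C" and T: "?T \<in> Ob D" using y functor_simps by auto
  have RT: "R ?T \<in> Ob C" and TT: "L (R ?T) \<in> Ob D" using T functor_simps by auto
  have e: "\<epsilon> y \<in> arr D ?T y" and eT: "\<epsilon> ?T \<in> arr D (L (R ?T)) ?T" using counit_in y T by auto
  have Rp: "R1 p \<in> arr C (R ?T) (R y)" using functor_simps T y p by blast
  have Tp: "L1 (R1 p) \<in> arr D (L (R ?T)) ?T" using functor_simps RT Ry Rp by blast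
  have d: "L1 (\<eta> (R y)) \<in> arr D ?T (L (R ?T))" using functor_simps RT Ry unit_in by blast
  \<comment> \<open>\<open>L1 (\<eta> (R y))\<close> is the comultiplication of the comonad of the
    adjunction at \<open>y\<close>; \<open>c\<close> follows it by the comonad applied to
    \<open>p\<close>, so that the counit after \<open>c\<close> is \<open>p\<close>.\<close>
  define c where "c = L1 (R1 p) \<cdot>\<^bsub>D\<^esub> L1 (\<eta> (R y))"
  have c: "c \<in> arr D ?T ?T" unfolding c_def using D.cmp_closed[OF T TT T d Tp] .
  have ec: "\<epsilon> y \<cdot>\<^bsub>D\<^esub> c = p"
  proof -
    have "\<epsilon> y \<cdot>\<^bsub>D\<^esub> c = (\<epsilon> y \<cdot>\<^bsub>D\<^esub> L1 (R1 p)) \<cdot>\<^bsub>D\<^esub> L1 (\<eta> (R y))"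
      unfolding c_def using D.cmp_assoc[OF T TT T y d Tp e] by simp
    also have "\<dots> = (p \<cdot>\<^bsub>D\<^esub> \<epsilon> ?T) \<cdot>\<^bsub>D\<^esub> L1 (\<eta> (R y))" using counit_nat[OF T y p] by simp
    also have "\<dots> = p"
      using D.cmp_assoc[OF T TT T y d eT p] triangle_L[OF Ry] D.ide_right[OF T y p] by simp
    finally show ?thesis .
  qed
  \<comment> \<open>The counit and \<open>c\<close>, carried over to endomorphisms of
    \<open>y\<close> along \<open>p\<close> and \<open>q\<close>.\<close>
  define a b where "a = \<epsilon> y \<cdot>\<^bsub>D\<^esub> q" and "b = (p \<cdot>\<^bsub>D\<^esub> c) \<cdot>\<^bsub>D\<^esub> q"
  have pc: "p \<cdot>\<^bsub>D\<^esub> c \<in> arr D ?T y" using D.cmp_closed[OF T T y c p] .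
  have a: "a \<in> arr D y y" and b: "b \<in> arr D y y"
    unfolding a_def b_def using D.cmp_closed[OF y T y q] e pc by auto
  have q_pc: "q \<cdot>\<^bsub>D\<^esub> (p \<cdot>\<^bsub>D\<^esub> c) = c"
    using D.cmp_assoc[OF T T y T c p q] qp D.ide_left[OF T T c] by simp
  have qb: "q \<cdot>\<^bsub>D\<^esub> b = c \<cdot>\<^bsub>D\<^esub> q"
    unfolding b_def using D.cmp_assoc[OF y T y T q pc q] q_pc by simp
  have "a \<cdot>\<^bsub>D\<^esub> b = \<epsilon> y \<cdot>\<^bsub>D\<^esub> (c \<cdot>\<^bsub>D\<^esub> q)"
    unfolding a_def using D.cmp_assoc[OF y y T y b q e] qb by simp
  also have "\<dots> = ide D y" using D.cmp_assoc[OF y T T y q c e] ec pq by simp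
  finally have ab: "a \<cdot>\<^bsub>D\<^esub> b = ide D y" .
  then have ba: "b \<cdot>\<^bsub>D\<^esub> a = ide D y" using comm a b by metis
  have ap: "a \<cdot>\<^bsub>D\<^esub> p = \<epsilon> y"
    unfolding a_def using D.cmp_assoc[OF T y T y p q e] qp D.ide_right[OF T y e] by simp
  have qb_in: "q \<cdot>\<^bsub>D\<^esub> b \<in> arr D y ?T" using D.cmp_closed[OF y y T b q] .
  have "\<epsilon> y \<cdot>\<^bsub>D\<^esub> (q \<cdot>\<^bsub>D\<^esub> b) = ide D y"
    using D.cmp_assoc[OF y y T y b q e] ab unfolding a_def by simp
  moreover have "(q \<cdot>\<^bsub>D\<^esub> b) \<cdot>\<^bsub>D\<^esub> \<epsilon> y = ide D ?T"
  proof -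
    have "b \<cdot>\<^bsub>D\<^esub> \<epsilon> y = p"
      using ap D.cmp_assoc[OF T y y y p a b] ba D.ide_left[OF T y p] by simp
    then show ?thesis using D.cmp_assoc[OF T y y T e b q] qp by simp
  qed
  ultimately show ?thesis unfolding iso_arr_def using e qb_in by blast
qed

end

section \<open>Whiskering with adjoint 1-morphisms\<close>

text \<open>2-morphisms need not be determined by their components, so two conditions are carried
  through the induction together: full faithfulness of the underlying functor, and bijectivity of
  whiskering from the endomorphisms of the unit.\<close>

definition hom_ff :: "('k, 'f, 'm, 'o, 'p) two_cat \<Rightarrow> 'k \<Rightarrow> 'k \<Rightarrow> 'f \<Rightarrow> bool" where
  "hom_ff K a b P \<longleftrightarrow> P \<in> mor1 K a b
     \<and> fully_faithful (Und K a) (Und K b) (actO K P) (actM K P)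
     \<and> bij_betw (\<lambda>\<alpha>. hc2 K (ide (HomC K a b) P) \<alpha>)
         (mor2 K a a (unit1 K a) (unit1 K a)) (mor2 K a b P P)"

section \<open>Whiskering, underlying functors and the adjunctions they inherit\<close>

context triangulated_two_category
begin

lemma hom_lin: "\<lbrakk>a \<in> Cells K; b \<in> Cells K\<rbrakk> \<Longrightarrow> lin_category (HomC K a b)"
  using hom_triangulated triangulated_category.lin_category by blast

lemma und_lin: "a \<in> Cells K \<Longrightarrow> lin_category (Und K a)"
  using und_triangulated triangulated_category.lin_category by blast

lemma ide2_in: "\<lbrakk>a \<in> Cells K; b \<in> Cells K; F \<in> mor1 K a b\<rbrakk> \<Longrightarrow> ide (HomC K a b) F \<in> mor2 K a b F F"
  using hom_lin lin_category.ide_in by metis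

lemma hc2_in: "\<lbrakk>a \<in> Cells K; b \<in> Cells K; c \<in> Cells K;
    F \<in> mor1 K a b; F' \<in> mor1 K a b; G \<in> mor1 K b c; G' \<in> mor1 K b c;
    \<alpha> \<in> mor2 K a b F F'; \<beta> \<in> mor2 K b c G G'\<rbrakk>
  \<Longrightarrow> \<beta> \<star> \<alpha> \<in> mor2 K a c (G \<bullet> F) (G' \<bullet> F')"
  using linear_map_closed[OF hc2_linear_right] by blast

lemma whisker_left: "\<lbrakk>a \<in> Cells K; b \<in> Cells K; c \<in> Cells K; G \<in> mor1 K b c\<rbrakk>
  \<Longrightarrow> linear_functor (HomC K a b) (HomC K a c) (\<lambda>F. G \<bullet> F) (\<lambda>\<alpha>. ide (HomC K b c) G \<star> \<alpha>)"
  using exact_left unfolding exact_functor_def by blast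

lemma whisker_right: "\<lbrakk>a \<in> Cells K; b \<in> Cells K; c \<in> Cells K; F \<in> mor1 K a b\<rbrakk>
  \<Longrightarrow> linear_functor (HomC K b c) (HomC K a c) (\<lambda>G. G \<bullet> F) (\<lambda>\<beta>. \<beta> \<star> ide (HomC K a b) F)"
  using exact_right unfolding exact_functor_def by blast

lemma act_linear_functor: "\<lbrakk>a \<in> Cells K; b \<in> Cells K; F \<in> mor1 K a b\<rbrakk>
  \<Longrightarrow> linear_functor (Und K a) (Und K b) (actO K F) (actM K F)"
  using act_functor unfolding exact_functor_def by blast

lemma actO_unit1: "\<lbrakk>a \<in> Cells K; x \<in> Ob (Und K a)\<rbrakk> \<Longrightarrow> actO K (unit1 K a) x = x"
  using act_unit1 lin_category.ide_in[OF und_lin] by blast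

lemma actO_hc1: "\<lbrakk>a \<in> Cells K; b \<in> Cells K; c \<in> Cells K; F \<in> mor1 K a b; G \<in> mor1 K b c;
    x \<in> Ob (Und K a)\<rbrakk> \<Longrightarrow> actO K (G \<bullet> F) x = actO K G (actO K F x)"
  using act_hc1 lin_category.ide_in[OF und_lin] by blast

lemma actO_in: "\<lbrakk>a \<in> Cells K; b \<in> Cells K; F \<in> mor1 K a b; x \<in> Ob (Und K a)\<rbrakk>
    \<Longrightarrow> actO K F x \<in> Ob (Und K b)"
  using linear_functor_ob[OF act_linear_functor] by blast

lemma actN_in: "\<lbrakk>a \<in> Cells K; b \<in> Cells K; F \<in> mor1 K a b; G \<in> mor1 K a b;
    \<alpha> \<in> mor2 K a b F G; x \<in> Ob (Und K a)\<rbrakk> \<Longrightarrow> actN K \<alpha> x \<in> arr (Und K b) (actO K F x) (actO K G x)"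
  using linear_map_closed[OF act_linear] by blast

lemma actN_whisker_left:
  assumes "a \<in> Cells K" "b \<in> Cells K" "c \<in> Cells K" "F \<in> mor1 K a b" "F' \<in> mor1 K a b"
    "G \<in> mor1 K b c" "\<alpha> \<in> mor2 K a b F F'" "x \<in> Ob (Und K a)"
  shows "actN K (ide (HomC K b c) G \<star> \<alpha>) x = actM K G (actN K \<alpha> x)"
proof -
  have m: "actM K G (actN K \<alpha> x) \<in> arr (Und K c) (actO K G (actO K F x)) (actO K G (actO K F' x))"
    using assms by (intro linear_functor_arr[OF act_linear_functor] actO_in actN_in)
  then show ?thesis
    using act_hc2[OF assms(1-6) assms(6,7) ide2_in assms(8)] act_ide actO_in
      lin_category.ide_left[OF und_lin _ _ m] assms by simp
qed

lemma actN_whisker_right: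
  assumes "a \<in> Cells K" "b \<in> Cells K" "c \<in> Cells K" "F \<in> mor1 K a b" "G \<in> mor1 K b c"
    "G' \<in> mor1 K b c" "\<beta> \<in> mor2 K b c G G'" "x \<in> Ob (Und K a)"
  shows "actN K (\<beta> \<star> ide (HomC K a b) F) x = actN K \<beta> (actO K F x)"
proof -
  have m: "actN K \<beta> (actO K F x) \<in> arr (Und K c) (actO K G (actO K F x)) (actO K G' (actO K F x))"
    using assms by (intro actO_in actN_in)
  then show ?thesis
    using act_hc2[OF assms(1-4) assms(4-6) ide2_in assms(7,8)] act_ide actO_in
      linear_functor_ide[OF act_linear_functor] lin_category.ide_right[OF und_lin _ _ m] assms
    by simp
qed

text \<open>Whiskering with identities on the right turns \<open>u\<close> and \<open>e\<close> into
  natural families by the interchange law: both sides of a naturality square equal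
  \<open>u \<star> f\<close>, respectively \<open>e \<star> g\<close>. The triangle identities are
  those of the pair, whiskered in the same way.\<close>

lemma hom_adjunction:
  assumes cl: "a \<in> Cells K" "b \<in> Cells K" "c \<in> Cells K"
    and L: "L \<in> mor1 K a b" and R: "R \<in> mor1 K b a"
    and u: "u \<in> mor2 K a a (unit1 K a) (R \<bullet> L)" and e: "e \<in> mor2 K b b (L \<bullet> R) (unit1 K b)"
    and tL: "(e \<star> ide (HomC K a b) L) \<cdot>\<^bsub>HomC K a b\<^esub> (ide (HomC K a b) L \<star> u) = ide (HomC K a b) L"
    and tR: "(ide (HomC K b a) R \<star> e) \<cdot>\<^bsub>HomC K b a\<^esub> (u \<star> ide (HomC K b a) R) = ide (HomC K b a) R"
  shows "linear_adjunction (HomC K c a) (HomC K c b)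
    (\<lambda>F. L \<bullet> F) (\<lambda>\<alpha>. ide (HomC K a b) L \<star> \<alpha>) (\<lambda>G. R \<bullet> G) (\<lambda>\<beta>. ide (HomC K b a) R \<star> \<beta>)
    (\<lambda>F. u \<star> ide (HomC K c a) F) (\<lambda>G. e \<star> ide (HomC K c b) G)"
proof -
  note units = unit1_in[OF cl(1)] unit1_in[OF cl(2)]
  note RL = hc1_in[OF cl(1,2,1) L R] and LR = hc1_in[OF cl(2,1,2) R L]
  note iL = ide2_in[OF cl(1,2) L] and iR = ide2_in[OF cl(2,1) R]
  have uL: "u \<star> ide (HomC K c a) F \<in> mor2 K c a F (R \<bullet> (L \<bullet> F))" if F: "F \<in> mor1 K c a" for F
    using hc2_in[OF cl(3,1,1) F F units(1) RL ide2_in[OF cl(3,1) F] u]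
      unit1_left[OF cl(3,1) F] hc1_assoc[OF cl(3,1,2,1) F L R] by simp
  have eR: "e \<star> ide (HomC K c b) G \<in> mor2 K c b (L \<bullet> (R \<bullet> G)) G" if G: "G \<in> mor1 K c b" for G
    using hc2_in[OF cl(3,2,2) G G LR units(2) ide2_in[OF cl(3,2) G] e]
      unit1_left[OF cl(3,2) G] hc1_assoc[OF cl(3,2,1,2) G R L] by simp
  interpret Ca: lin_category "HomC K c a" using hom_lin cl by blast
  interpret Cb: lin_category "HomC K c b" using hom_lin cl by blast
  interpret Caa: lin_category "HomC K a a" using hom_lin cl by blast
  interpret Cbb: lin_category "HomC K b b" using hom_lin cl by blast
  have natu: "(u \<star> ide (HomC K c a) F') \<cdot>\<^bsub>HomC K c a\<^esub> f
      = (ide (HomC K b a) R \<star> (ide (HomC K a b) L \<star> f)) \<cdot>\<^bsub>HomC K c a\<^esub> (u \<star> ide (HomC K c a) F)"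
    if F: "F \<in> mor1 K c a" and F': "F' \<in> mor1 K c a" and f: "f \<in> mor2 K c a F F'" for F F' f
  proof -
    have "(u \<star> ide (HomC K c a) F') \<cdot>\<^bsub>HomC K c a\<^esub> f = u \<star> f"
      using interchange[OF cl(3,1,1) F F' F' units(1,1) RL f ide2_in[OF cl(3,1) F']
          ide2_in[OF cl(1,1) units(1)] u]
        hc2_unit_left[OF cl(3,1) F F' f] Ca.ide_left[OF F F' f] Caa.ide_right[OF units(1) RL u] by simp
    also have "\<dots> = (ide (HomC K a a) (R \<bullet> L) \<star> f) \<cdot>\<^bsub>HomC K c a\<^esub> (u \<star> ide (HomC K c a) F)"
      using interchange[OF cl(3,1,1) F F F' units(1) RL RL ide2_in[OF cl(3,1) F] f u
          ide2_in[OF cl(1,1) RL]]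
        Ca.ide_right[OF F F' f] Caa.ide_left[OF units(1) RL u] by simp
    also have "ide (HomC K a a) (R \<bullet> L) \<star> f = ide (HomC K b a) R \<star> (ide (HomC K a b) L \<star> f)"
      using hc2_ide[OF cl(1,2,1) L R] hc2_assoc[OF cl(3,1,2,1) F F' L L R R f iL iR] by simp
    finally show ?thesis .
  qed
  have nate: "(e \<star> ide (HomC K c b) G') \<cdot>\<^bsub>HomC K c b\<^esub> (ide (HomC K a b) L \<star> (ide (HomC K b a) R \<star> g))
      = g \<cdot>\<^bsub>HomC K c b\<^esub> (e \<star> ide (HomC K c b) G)"
    if G: "G \<in> mor1 K c b" and G': "G' \<in> mor1 K c b" and g: "g \<in> mor2 K c b G G'" for G G' g
  proof -
    have "ide (HomC K b b) (L \<bullet> R) \<star> g = ide (HomC K a b) L \<star> (ide (HomC K b a) R \<star> g)"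
      using hc2_ide[OF cl(2,1,2) R L] hc2_assoc[OF cl(3,2,1,2) G G' R R L L g iR iL] by simp
    then have "(e \<star> ide (HomC K c b) G') \<cdot>\<^bsub>HomC K c b\<^esub>
        (ide (HomC K a b) L \<star> (ide (HomC K b a) R \<star> g)) = e \<star> g"
      using interchange[OF cl(3,2,2) G G' G' LR LR units(2) g ide2_in[OF cl(3,2) G']
          ide2_in[OF cl(2,2) LR] e]
        Cb.ide_left[OF G G' g] Cbb.ide_right[OF LR units(2) e] by simp
    also have "\<dots> = g \<cdot>\<^bsub>HomC K c b\<^esub> (e \<star> ide (HomC K c b) G)"
      using interchange[OF cl(3,2,2) G G G' LR units(2,2) ide2_in[OF cl(3,2) G] g e
          ide2_in[OF cl(2,2) units(2)]]
        hc2_unit_left[OF cl(3,2) G G' g] Cb.ide_right[OF G G' g] Cbb.ide_left[OF LR units(2) e]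
      by simp
    finally show ?thesis .
  qed
  have LRL: "L \<bullet> (R \<bullet> L) \<in> mor1 K a b" "(L \<bullet> R) \<bullet> L = L \<bullet> (R \<bullet> L)"
    and RLR: "R \<bullet> (L \<bullet> R) \<in> mor1 K b a" "(R \<bullet> L) \<bullet> R = R \<bullet> (L \<bullet> R)"
    using hc1_in hc1_assoc cl L R RL LR by metis+
  have Lu: "ide (HomC K a b) L \<star> u \<in> mor2 K a b L (L \<bullet> (R \<bullet> L))"
    using hc2_in[OF cl(1,1,2) units(1) RL L L u iL] unit1_right[OF cl(1,2) L] by simp
  have eL: "e \<star> ide (HomC K a b) L \<in> mor2 K a b (L \<bullet> (R \<bullet> L)) L"
    using hc2_in[OF cl(1,2,2) L L LR units(2) iL e] unit1_left[OF cl(1,2) L] LRL by simp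
  have uR: "u \<star> ide (HomC K b a) R \<in> mor2 K b a R (R \<bullet> (L \<bullet> R))"
    using hc2_in[OF cl(2,1,1) R R units(1) RL iR u] unit1_left[OF cl(2,1) R] RLR by simp
  have Re: "ide (HomC K b a) R \<star> e \<in> mor2 K b a (R \<bullet> (L \<bullet> R)) R"
    using hc2_in[OF cl(2,2,1) LR units(2) R R e iR] unit1_right[OF cl(2,1) R] by simp
  show ?thesis
  proof
    fix F assume F: "F \<in> mor1 K c a"
    note iF = ide2_in[OF cl(3,1) F]
    have 1: "e \<star> ide (HomC K c b) (L \<bullet> F) = (e \<star> ide (HomC K a b) L) \<star> ide (HomC K c a) F"
      using hc2_ide[OF cl(3,1,2) F L] hc2_assoc[OF cl(3,1,2,2) F F L L LR units(2) iF iL e] by simp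
    have 2: "ide (HomC K a b) L \<star> (u \<star> ide (HomC K c a) F)
        = (ide (HomC K a b) L \<star> u) \<star> ide (HomC K c a) F"
      using hc2_assoc[OF cl(3,1,1,2) F F units(1) RL L L iF u iL] by simp
    show "(e \<star> ide (HomC K c b) (L \<bullet> F)) \<cdot>\<^bsub>HomC K c b\<^esub>
        (ide (HomC K a b) L \<star> (u \<star> ide (HomC K c a) F)) = ide (HomC K c b) (L \<bullet> F)"
      unfolding 1 2 using interchange[OF cl(3,1,2) F F F L LRL(1) L iF iF Lu eL] tL
        hc2_ide[OF cl(3,1,2) F L] Ca.ide_left[OF F F iF] by simp
  next
    fix G assume G: "G \<in> mor1 K c b"
    note iG = ide2_in[OF cl(3,2) G]
    have 1: "u \<star> ide (HomC K c a) (R \<bullet> G) = (u \<star> ide (HomC K b a) R) \<star> ide (HomC K c b) G"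
      using hc2_ide[OF cl(3,2,1) G R] hc2_assoc[OF cl(3,2,1,1) G G R R units(1) RL iG iR u] by simp
    have 2: "ide (HomC K b a) R \<star> (e \<star> ide (HomC K c b) G)
        = (ide (HomC K b a) R \<star> e) \<star> ide (HomC K c b) G"
      using hc2_assoc[OF cl(3,2,2,1) G G LR units(2) R R iG e iR] by simp
    show "(ide (HomC K b a) R \<star> (e \<star> ide (HomC K c b) G)) \<cdot>\<^bsub>HomC K c a\<^esub>
        (u \<star> ide (HomC K c a) (R \<bullet> G)) = ide (HomC K c a) (R \<bullet> G)"
      unfolding 1 2 using interchange[OF cl(3,2,1) G G G R RLR(1) R iG iG uR Re] tR
        hc2_ide[OF cl(3,2,1) G R] Cb.ide_left[OF G G iG] by simp
  qed (use whisker_left cl L R uL eR natu nate in auto)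
qed

text \<open>Taking components is compatible with both compositions of 2-morphisms, so the identities
  of the pair hold at every object.\<close>

lemma und_adjunction:
  assumes cl: "a \<in> Cells K" "b \<in> Cells K"
    and L: "L \<in> mor1 K a b" and R: "R \<in> mor1 K b a"
    and u: "u \<in> mor2 K a a (unit1 K a) (R \<bullet> L)" and e: "e \<in> mor2 K b b (L \<bullet> R) (unit1 K b)"
    and tL: "(e \<star> ide (HomC K a b) L) \<cdot>\<^bsub>HomC K a b\<^esub> (ide (HomC K a b) L \<star> u) = ide (HomC K a b) L"
    and tR: "(ide (HomC K b a) R \<star> e) \<cdot>\<^bsub>HomC K b a\<^esub> (u \<star> ide (HomC K b a) R) = ide (HomC K b a) R"
  shows "linear_adjunction (Und K a) (Und K b) (actO K L) (actM K L) (actO K R) (actM K R)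
    (actN K u) (actN K e)"
proof -
  note units = unit1_in[OF cl(1)] unit1_in[OF cl(2)]
  note RL = hc1_in[OF cl(1,2,1) L R] and LR = hc1_in[OF cl(2,1,2) R L]
  note iL = ide2_in[OF cl(1,2) L] and iR = ide2_in[OF cl(2,1) R]
  have LRL: "L \<bullet> (R \<bullet> L) \<in> mor1 K a b" "(L \<bullet> R) \<bullet> L = L \<bullet> (R \<bullet> L)"
    and RLR: "R \<bullet> (L \<bullet> R) \<in> mor1 K b a" "(R \<bullet> L) \<bullet> R = R \<bullet> (L \<bullet> R)"
    using hc1_in hc1_assoc cl L R RL LR by metis+
  have Lu: "ide (HomC K a b) L \<star> u \<in> mor2 K a b L (L \<bullet> (R \<bullet> L))"
    using hc2_in[OF cl(1,1,2) units(1) RL L L u iL] unit1_right[OF cl(1,2) L] by simp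
  have eL: "e \<star> ide (HomC K a b) L \<in> mor2 K a b (L \<bullet> (R \<bullet> L)) L"
    using hc2_in[OF cl(1,2,2) L L LR units(2) iL e] unit1_left[OF cl(1,2) L] LRL by simp
  have uR: "u \<star> ide (HomC K b a) R \<in> mor2 K b a R (R \<bullet> (L \<bullet> R))"
    using hc2_in[OF cl(2,1,1) R R units(1) RL iR u] unit1_left[OF cl(2,1) R] RLR by simp
  have Re: "ide (HomC K b a) R \<star> e \<in> mor2 K b a (R \<bullet> (L \<bullet> R)) R"
    using hc2_in[OF cl(2,2,1) LR units(2) R R e iR] unit1_right[OF cl(2,1) R] by simp
  interpret Ua: lin_category "Und K a" using und_lin cl by blast
  interpret Ub: lin_category "Und K b" using und_lin cl by blast
  show ?thesis
  proof
    show "linear_functor (Und K a) (Und K b) (actO K L) (actM K L)"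
      "linear_functor (Und K b) (Und K a) (actO K R) (actM K R)"
      using act_linear_functor cl L R by auto
  next
    fix x assume x: "x \<in> Ob (Und K a)"
    show "actN K u x \<in> arr (Und K a) x (actO K R (actO K L x))"
      using actN_in[OF cl(1,1) units(1) RL u x] actO_unit1[OF cl(1) x]
        actO_hc1[OF cl(1,2,1) L R x] by simp
    show "actN K e (actO K L x) \<cdot>\<^bsub>Und K b\<^esub> actM K L (actN K u x) = ide (Und K b) (actO K L x)"
      using act_cmp[OF cl L LRL(1) L Lu eL x] tL act_ide[OF cl L x]
        actN_whisker_right[OF cl(1,2,2) L LR units(2) e x]
        actN_whisker_left[OF cl(1,1,2) units(1) RL L u x] by simp
  next
    fix y assume y: "y \<in> Ob (Und K b)"
    show "actN K e y \<in> arr (Und K b) (actO K L (actO K R y)) y"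
      using actN_in[OF cl(2,2) LR units(2) e y] actO_unit1[OF cl(2) y]
        actO_hc1[OF cl(2,1,2) R L y] by simp
    show "actM K R (actN K e y) \<cdot>\<^bsub>Und K a\<^esub> actN K u (actO K R y) = ide (Und K a) (actO K R y)"
      using act_cmp[OF cl(2,1) R RLR(1) R uR Re y] tR act_ide[OF cl(2,1) R y]
        actN_whisker_right[OF cl(2,1,1) R units(1) RL u y]
        actN_whisker_left[OF cl(2,2,1) LR units(2) R e y] by simp
  next
    fix x x' f assume x: "x \<in> Ob (Und K a)" "x' \<in> Ob (Und K a)" and f: "f \<in> arr (Und K a) x x'"
    show "actN K u x' \<cdot>\<^bsub>Und K a\<^esub> f = actM K R (actM K L f) \<cdot>\<^bsub>Und K a\<^esub> actN K u x"
      using act_natural[OF cl(1,1) units(1) RL u x f] act_unit1[OF cl(1) x f]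
        act_hc1[OF cl(1,2,1) L R x f] by simp
  next
    fix y y' g assume y: "y \<in> Ob (Und K b)" "y' \<in> Ob (Und K b)" and g: "g \<in> arr (Und K b) y y'"
    show "actN K e y' \<cdot>\<^bsub>Und K b\<^esub> actM K L (actM K R g) = g \<cdot>\<^bsub>Und K b\<^esub> actN K e y"
      using act_natural[OF cl(2,2) LR units(2) e y g] act_unit1[OF cl(2) y g]
        act_hc1[OF cl(2,1,2) R L y g] by simp
  qed
qed

text \<open>The Eckmann-Hilton argument.\<close>

lemma unit1_end_commute:
  assumes a: "a \<in> Cells K" and \<alpha>: "\<alpha> \<in> mor2 K a a (unit1 K a) (unit1 K a)"
    and \<beta>: "\<beta> \<in> mor2 K a a (unit1 K a) (unit1 K a)"
  shows "\<alpha> \<cdot>\<^bsub>HomC K a a\<^esub> \<beta> = \<beta> \<cdot>\<^bsub>HomC K a a\<^esub> \<alpha>"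
proof -
  note one = unit1_in[OF a]
  note i = ide2_in[OF a a one]
  interpret lin_category "HomC K a a" using hom_lin a by blast
  have "\<alpha> \<cdot>\<^bsub>HomC K a a\<^esub> \<beta> = \<alpha> \<star> \<beta>"
    using interchange[OF a a a one one one one one one \<beta> i i \<alpha>]
      hc2_unit_left[OF a a one one \<beta>] hc2_unit_right[OF a a one one \<alpha>]
      ide_left[OF one one \<beta>] ide_right[OF one one \<alpha>] by simp
  also have "\<dots> = \<beta> \<cdot>\<^bsub>HomC K a a\<^esub> \<alpha>"
    using interchange[OF a a a one one one one one one i \<beta> \<alpha> i]
      hc2_unit_left[OF a a one one \<beta>] hc2_unit_right[OF a a one one \<alpha>]
      ide_left[OF one one \<alpha>] ide_right[OF one one \<beta>] by simp
  finally show ?thesis .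
qed

lemma hom_ff_unit1:
  assumes a: "a \<in> Cells K"
  shows "hom_ff K a a (unit1 K a)"
proof -
  have "bij_betw (actM K (unit1 K a)) (arr (Und K a) x y) (arr (Und K a) x y)"
    if "x \<in> Ob (Und K a)" "y \<in> Ob (Und K a)" for x y
    using act_unit1[OF a that] bij_betw_cong[of _ _ id] by (metis bij_betw_id eq_id_iff)
  moreover have "bij_betw (\<lambda>\<alpha>. ide (HomC K a a) (unit1 K a) \<star> \<alpha>)
      (mor2 K a a (unit1 K a) (unit1 K a)) (mor2 K a a (unit1 K a) (unit1 K a))"
    using hc2_unit_left[OF a a unit1_in[OF a] unit1_in[OF a]] bij_betw_cong[of _ _ id]
    by (metis (no_types, lifting) bij_betw_id eq_id_iff)
  ultimately show ?thesis
    unfolding hom_ff_def fully_faithful_def using unit1_in a actO_unit1 by simp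
qed

text \<open>Whiskering with \<open>P\<close> is onto, so both endomorphisms lift to the unit
  1-morphism, whose endomorphisms commute. This supplies the commutativity required for inverting
  the counit.\<close>

lemma hom_ff_end_commute:
  assumes cl: "a \<in> Cells K" "b \<in> Cells K" and P: "hom_ff K a b P"
    and \<alpha>: "\<alpha> \<in> mor2 K a b P P" and \<beta>: "\<beta> \<in> mor2 K a b P P"
  shows "\<alpha> \<cdot>\<^bsub>HomC K a b\<^esub> \<beta> = \<beta> \<cdot>\<^bsub>HomC K a b\<^esub> \<alpha>"
proof -
  note one = unit1_in[OF cl(1)]
  have P1: "P \<in> mor1 K a b" using P unfolding hom_ff_def by blast
  have surj: "(\<lambda>\<alpha>. ide (HomC K a b) P \<star> \<alpha>) ` mor2 K a a (unit1 K a) (unit1 K a) = mor2 K a b P P"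
    using P unfolding hom_ff_def bij_betw_def by blast
  obtain \<alpha>' \<beta>' where \<alpha>': "\<alpha>' \<in> mor2 K a a (unit1 K a) (unit1 K a)" "\<alpha> = ide (HomC K a b) P \<star> \<alpha>'"
    and \<beta>': "\<beta>' \<in> mor2 K a a (unit1 K a) (unit1 K a)" "\<beta> = ide (HomC K a b) P \<star> \<beta>'"
    using \<alpha> \<beta> surj by blast
  note F = whisker_left[OF cl(1,1,2) P1]
  show ?thesis
    using linear_functor_cmp[OF F one one one \<alpha>'(1) \<beta>'(1)]
      linear_functor_cmp[OF F one one one \<beta>'(1) \<alpha>'(1)]
      unit1_end_commute[OF cl(1) \<alpha>'(1) \<beta>'(1)] \<alpha>'(2) \<beta>'(2) by simp
qed

lemma actN_iso:
  assumes cl: "a \<in> Cells K" "b \<in> Cells K" and F: "F \<in> mor1 K a b" and G: "G \<in> mor1 K a b"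
    and x: "x \<in> Ob (Und K a)" and i: "iso_arr (HomC K a b) F G \<alpha>"
  shows "iso_arr (Und K b) (actO K F x) (actO K G x) (actN K \<alpha> x)"
proof -
  obtain \<beta> where "\<alpha> \<in> mor2 K a b F G" "\<beta> \<in> mor2 K a b G F"
    "\<beta> \<cdot>\<^bsub>HomC K a b\<^esub> \<alpha> = ide (HomC K a b) F" "\<alpha> \<cdot>\<^bsub>HomC K a b\<^esub> \<beta> = ide (HomC K a b) G"
    using i unfolding iso_arr_def by blast
  then show ?thesis
    unfolding iso_arr_def
    using actN_in[OF cl F G _ x] actN_in[OF cl G F _ x] act_cmp[OF cl F G F _ _ x]
      act_cmp[OF cl G F G _ _ x] act_ide[OF cl F x] act_ide[OF cl G x] by metis
qed

text \<open>The given isomorphism is arbitrary; since endomorphisms of \<open>P\<close> commute, the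
  counit at \<open>P\<close> is invertible as well. Then \<open>R\<close> is bijective on morphisms
  out of \<open>P\<close>, and the property of \<open>R \<bullet> P\<close> is composed from that of
  \<open>P\<close>. The second claim lets \<open>R\<close> be cancelled in Homs from
  \<open>R \<bullet> P\<close> to any \<open>R \<bullet> Q\<close>.\<close>

lemma hom_ff_right_adjoint:
  assumes cl: "a \<in> Cells K" "b \<in> Cells K" "c \<in> Cells K"
    and adj: "adjoint_pair K c b L R" and ff: "hom_ff K a b P"
    and iso: "isomorphic (HomC K a b) (L \<bullet> (R \<bullet> P)) P"
  shows "hom_ff K a c (R \<bullet> P)"
    and "Q \<in> mor1 K a b \<Longrightarrow>
      bij_betw (\<lambda>\<beta>. ide (HomC K b c) R \<star> \<beta>) (mor2 K a b P Q) (mor2 K a c (R \<bullet> P) (R \<bullet> Q))"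
proof -
  have P: "P \<in> mor1 K a b" using ff unfolding hom_ff_def by blast
  obtain u e where L: "L \<in> mor1 K c b" and R: "R \<in> mor1 K b c"
    and u: "u \<in> mor2 K c c (unit1 K c) (R \<bullet> L)" and e: "e \<in> mor2 K b b (L \<bullet> R) (unit1 K b)"
    and tL: "(e \<star> ide (HomC K c b) L) \<cdot>\<^bsub>HomC K c b\<^esub> (ide (HomC K c b) L \<star> u) = ide (HomC K c b) L"
    and tR: "(ide (HomC K b c) R \<star> e) \<cdot>\<^bsub>HomC K b c\<^esub> (u \<star> ide (HomC K b c) R) = ide (HomC K b c) R"
    using adj unfolding adjoint_pair_def by blast
  interpret H: linear_adjunction "HomC K a c" "HomC K a b"
    "\<lambda>F. L \<bullet> F" "\<lambda>\<alpha>. ide (HomC K c b) L \<star> \<alpha>" "\<lambda>G. R \<bullet> G" "\<lambda>\<beta>. ide (HomC K b c) R \<star> \<beta>"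
    "\<lambda>F. u \<star> ide (HomC K a c) F" "\<lambda>G. e \<star> ide (HomC K a b) G"
    by (rule hom_adjunction[OF cl(3,2,1) L R u e tL tR])
  interpret U: linear_adjunction "Und K c" "Und K b"
    "actO K L" "actM K L" "actO K R" "actM K R" "actN K u" "actN K e"
    by (rule und_adjunction[OF cl(3,2) L R u e tL tR])
  have counit: "iso_arr (HomC K a b) (L \<bullet> (R \<bullet> P)) P (e \<star> ide (HomC K a b) P)"
    using H.counit_iso[OF P iso] hom_ff_end_commute[OF cl(1,2) ff] by blast
  show bij: "bij_betw (\<lambda>\<beta>. ide (HomC K b c) R \<star> \<beta>) (mor2 K a b P Q) (mor2 K a c (R \<bullet> P) (R \<bullet> Q))"
    if "Q \<in> mor1 K a b" for Q
    using H.hom_bij[OF P that counit] .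
  note one = unit1_in[OF cl(1)] and RP = hc1_in[OF cl P R]
  note LRP = hc1_in[OF cl(1,3,2) RP L]
  have "bij_betw (actM K (R \<bullet> P)) (arr (Und K a) x y)
      (arr (Und K c) (actO K (R \<bullet> P) x) (actO K (R \<bullet> P) y))"
    if x: "x \<in> Ob (Und K a)" and y: "y \<in> Ob (Und K a)" for x y
  proof -
    have Pxy: "actO K P x \<in> Ob (Und K b)" "actO K P y \<in> Ob (Und K b)"
      using actO_in[OF cl(1,2) P] x y by auto
    \<comment> \<open>The component at \<open>x\<close> of the counit whiskered with
      \<open>P\<close> is the component of \<open>e\<close> at \<open>actO K P x\<close>. Hence
      invertibility passes to the underlying functors at objects in the image of
      \<open>P\<close>.\<close>
    have "iso_arr (Und K b) (actO K L (actO K R (actO K P x))) (actO K P x) (actN K e (actO K P x))"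
      using actN_iso[OF cl(1,2) LRP P x counit] actO_hc1[OF cl(1,3,2) RP L x] actO_hc1[OF cl P R x]
        actN_whisker_right[OF cl(1,2,2) P hc1_in[OF cl(2,3,2) R L] unit1_in[OF cl(2)] e x]
      by simp
    then have "bij_betw (actM K R) (arr (Und K b) (actO K P x) (actO K P y))
        (arr (Und K c) (actO K R (actO K P x)) (actO K R (actO K P y)))"
      using U.hom_bij[OF Pxy] by blast
    moreover have "bij_betw (actM K P) (arr (Und K a) x y) (arr (Und K b) (actO K P x) (actO K P y))"
      using ff x y unfolding hom_ff_def fully_faithful_def by blast
    ultimately have "bij_betw (actM K R \<circ> actM K P) (arr (Und K a) x y)
        (arr (Und K c) (actO K R (actO K P x)) (actO K R (actO K P y)))"
      using bij_betw_trans by blast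
    then show ?thesis
      using actO_hc1[OF cl P R] act_hc1[OF cl P R x y] x y
      by (subst bij_betw_cong[where g = "actM K R \<circ> actM K P"]) auto
  qed
  moreover have "bij_betw (\<lambda>\<alpha>. ide (HomC K a c) (R \<bullet> P) \<star> \<alpha>)
      (mor2 K a a (unit1 K a) (unit1 K a)) (mor2 K a c (R \<bullet> P) (R \<bullet> P))"
  proof -
    \<comment> \<open>Whiskering with \<open>R \<bullet> P\<close> is whiskering with
      \<open>P\<close> followed by whiskering with \<open>R\<close>.\<close>
    have "ide (HomC K a c) (R \<bullet> P) \<star> \<alpha> = ide (HomC K b c) R \<star> (ide (HomC K a b) P \<star> \<alpha>)"
      if "\<alpha> \<in> mor2 K a a (unit1 K a) (unit1 K a)" for \<alpha>
      using hc2_ide[OF cl P R] hc2_assoc[OF cl(1,1,2,3) one one P P R R that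
          ide2_in[OF cl(1,2) P] ide2_in[OF cl(2,3) R]] by simp
    moreover have "bij_betw ((\<lambda>\<beta>. ide (HomC K b c) R \<star> \<beta>) \<circ> (\<lambda>\<alpha>. ide (HomC K a b) P \<star> \<alpha>))
      (mor2 K a a (unit1 K a) (unit1 K a)) (mor2 K a c (R \<bullet> P) (R \<bullet> P))"
      using bij[OF P] ff unfolding hom_ff_def by (intro bij_betw_trans) auto
    ultimately show ?thesis
      by (subst bij_betw_cong) auto
  qed
  ultimately show "hom_ff K a c (R \<bullet> P)"
    unfolding hom_ff_def fully_faithful_def using RP by blast
qed

text \<open>The adjunct of such a 2-morphism starts at \<open>L \<bullet> P\<close>. All vanishing
  in the semiorthogonality originates here.\<close>

lemma hom_right_adjoint_zero:
  assumes cl: "a \<in> Cells K" "b \<in> Cells K" "c \<in> Cells K"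
    and adj: "adjoint_pair K c b L R" and P: "P \<in> mor1 K a c" and Q: "Q \<in> mor1 K a b"
    and z: "zero_object (HomC K a b) (L \<bullet> P)"
  shows "mor2 K a c P (R \<bullet> Q) = {\<zero>\<^bsub>Mor (HomC K a c) P (R \<bullet> Q)\<^esub>}"
proof -
  obtain u e where L: "L \<in> mor1 K c b" and R: "R \<in> mor1 K b c"
    and u: "u \<in> mor2 K c c (unit1 K c) (R \<bullet> L)" and e: "e \<in> mor2 K b b (L \<bullet> R) (unit1 K b)"
    and tL: "(e \<star> ide (HomC K c b) L) \<cdot>\<^bsub>HomC K c b\<^esub> (ide (HomC K c b) L \<star> u) = ide (HomC K c b) L"
    and tR: "(ide (HomC K b c) R \<star> e) \<cdot>\<^bsub>HomC K b c\<^esub> (u \<star> ide (HomC K b c) R) = ide (HomC K b c) R"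
    using adj unfolding adjoint_pair_def by blast
  interpret H: linear_adjunction "HomC K a c" "HomC K a b"
    "\<lambda>F. L \<bullet> F" "\<lambda>\<alpha>. ide (HomC K c b) L \<star> \<alpha>" "\<lambda>G. R \<bullet> G" "\<lambda>\<beta>. ide (HomC K b c) R \<star> \<beta>"
    "\<lambda>F. u \<star> ide (HomC K a c) F" "\<lambda>G. e \<star> ide (HomC K a b) G"
    by (rule hom_adjunction[OF cl(3,2,1) L R u e tL tR])
  show ?thesis using H.hom_eq_zero[OF P Q z] .
qed

lemma zero_object_whisker_left:
  "\<lbrakk>a \<in> Cells K; b \<in> Cells K; c \<in> Cells K; G \<in> mor1 K b c; zero_object (HomC K a b) F\<rbrakk>
    \<Longrightarrow> zero_object (HomC K a c) (G \<bullet> F)"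
  using linear_functor_zero_object[OF hom_lin hom_lin whisker_left] by blast

lemma zero_object_whisker_right:
  "\<lbrakk>a \<in> Cells K; b \<in> Cells K; c \<in> Cells K; F \<in> mor1 K a b; zero_object (HomC K b c) G\<rbrakk>
    \<Longrightarrow> zero_object (HomC K a c) (G \<bullet> F)"
  using linear_functor_zero_object[OF hom_lin hom_lin whisker_right] by blast

lemma isomorphic_whisker_right:
  "\<lbrakk>a \<in> Cells K; b \<in> Cells K; c \<in> Cells K; F \<in> mor1 K a b; G \<in> mor1 K b c; G' \<in> mor1 K b c;
    isomorphic (HomC K b c) G G'\<rbrakk> \<Longrightarrow> isomorphic (HomC K a c) (G \<bullet> F) (G' \<bullet> F)"
  unfolding isomorphic_def using linear_functor_iso_arr[OF whisker_right] by blast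

lemma shift_whisker_right:
  "\<lbrakk>a \<in> Cells K; b \<in> Cells K; c \<in> Cells K; F \<in> mor1 K a b; G \<in> mor1 K b c\<rbrakk>
    \<Longrightarrow> isomorphic (HomC K a c) (sh (HomC K b c) G \<bullet> F) (sh (HomC K a c) (G \<bullet> F))"
  unfolding isomorphic_def using exact_right unfolding exact_functor_def by blast

lemma triangle_whisker_right:
  "\<lbrakk>a \<in> Cells K; b \<in> Cells K; c \<in> Cells K; F \<in> mor1 K a b; exact_triangle (HomC K b c) G G' G''\<rbrakk>
    \<Longrightarrow> exact_triangle (HomC K a c) (G \<bullet> F) (G' \<bullet> F) (G'' \<bullet> F)"
  unfolding exact_triangle_def using exact_right unfolding exact_functor_def by blast

end

section \<open>Words in the generators\<close>

text \<open>Splitting off index 0 makes the order recursive, so that an induction on the parts can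
  compare first parts.\<close>

lemma lex_less_Cons: "lex_less (r # l) (r' # l') \<longleftrightarrow> r < r' \<or> r = r' \<and> lex_less l l'"
proof -
  have "lex_less (r # l) (r' # l') \<longleftrightarrow>
    (\<exists>j < Suc (min (length l) (length l')). (\<forall>i<j. (r # l) ! i = (r' # l') ! i) \<and> (r # l) ! j < (r' # l') ! j)"
    by (simp add: lex_less_def)
  also have "\<dots> \<longleftrightarrow> r < r' \<or> r = r' \<and> lex_less l l'"
    unfolding lex_less_def Ex_less_Suc2 All_less_Suc2 by auto
  finally show ?thesis .
qed

lemma young_diagrams_Cons:
  "r # l \<in> young_diagrams c b \<Longrightarrow> l \<in> young_diagrams c (b - 1) \<and> 0 \<le> r \<and> r \<le> c \<and> (\<forall>x\<in>set l. x \<le> r)"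
  by (auto simp: young_diagrams_def)

lemma young_diagrams_nth:
  "l \<in> young_diagrams c b \<Longrightarrow> j < length l \<Longrightarrow> 0 \<le> l ! j \<and> l ! j \<le> c"
  by (simp add: young_diagrams_def)

section \<open>Weights reached by words\<close>

lemma word_target_block:
  "word_target (map (Pair i) l @ w) a =
    (\<lambda>j. word_target w a j + (if j = i then int (length l) else if j = i + 1 then - int (length l) else 0))"
  by (induction l) (auto simp: simple_root_def fun_eq_iff)

lemma simple_root_weights: "i \<in> {1..n-1} \<Longrightarrow> simple_root i \<in> weights n"
  by (auto simp: weights_def simple_root_def)

lemma weights_add: "k \<in> weights n \<Longrightarrow> l \<in> weights n \<Longrightarrow> k + l \<in> weights n"
  by (auto simp: weights_def)

lemma weights_diff: "k \<in> weights n \<Longrightarrow> l \<in> weights n \<Longrightarrow> k - l \<in> weights n"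
  by (auto simp: weights_def)

lemma word_target_weights:
  "a \<in> weights n \<Longrightarrow> fst ` set w \<subseteq> {1..n-1} \<Longrightarrow> word_target w a \<in> weights n"
  by (induction w a rule: word_target.induct) (auto intro!: weights_diff simple_root_weights)

text \<open>The blocks from \<open>i\<close> on, which act first on the highest weight. Inductions
  start from the empty word at \<open>i = n\<close> and put block \<open>i\<close> in front of the
  tail at \<open>Suc i\<close>.\<close>

definition tail_word :: "nat \<Rightarrow> (nat \<Rightarrow> int list) \<Rightarrow> nat \<Rightarrow> (nat \<times> int) list" where
  "tail_word n \<mu> i = concat (map (\<lambda>i. map (Pair i) (\<mu> i)) [i..<n])"

lemma tail_word_step: "i < n \<Longrightarrow> tail_word n \<mu> i = map (Pair i) (\<mu> i) @ tail_word n \<mu> (Suc i)"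
  by (simp add: tail_word_def upt_conv_Cons)

lemma tail_word_end: "tail_word n \<mu> n = []"
  by (simp add: tail_word_def)

lemma tuple_word_eq: "tuple_word n \<mu> = tail_word n \<mu> 1"
  by (simp add: tail_word_def tuple_word_def)

lemma tail_word_letters: "1 \<le> i \<Longrightarrow> fst ` set (tail_word n \<mu> i) \<subseteq> {1..n-1}"
  by (auto simp: tail_word_def)

lemma highest_weight_weights: "1 \<le> n \<Longrightarrow> highest_weight n N \<in> weights n"
  by (auto simp: weights_def highest_weight_def)

text \<open>Block \<open>i\<close> has \<open>k 1 + ... + k i\<close> letters and moves that many
  units from position \<open>i + 1\<close> to position \<open>i\<close>, leaving
  \<open>k (i + 1)\<close> behind. Two consequences at the tail \<open>Suc i\<close> matter later:
  entry \<open>i\<close> is 0, and entry \<open>i + 1\<close> is the sum of the two sides of the box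
  containing \<open>\<mu> i\<close>.\<close>

lemma tail_target:
  assumes k: "k \<in> compositions n N" and \<mu>: "diagram_tuple n k \<mu>" and i: "1 \<le> i" "i \<le> n"
  shows "word_target (tail_word n \<mu> i) (highest_weight n N)
    = (\<lambda>j. if j < i then 0 else if j = i then (\<Sum>m=1..i. k m) else k j)"
  using i(2,1)
proof (induction i rule: inc_induct)
  case base
  then show ?case using k
    by (auto simp: tail_word_end highest_weight_def compositions_def weights_def fun_eq_iff)
next
  case (step i)
  have len: "int (length (\<mu> i)) = (\<Sum>m=1..i. k m)"
    using \<mu> step by (auto simp: diagram_tuple_def young_diagrams_def)
  show ?case
    unfolding tail_word_step[OF step(2)] word_target_block
    using step len by (auto simp: fun_eq_iff)
qed

section \<open>Vanishing of left adjoints, and the passage from block to block\<close>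

context categorical_Un_plus_action
begin

lemma cellsI: "v \<in> weights n \<Longrightarrow> v \<in> Cells K"
  using cells by simp

lemma root_weights:
  assumes "v \<in> weights n" "i \<in> {1..n-1}"
  shows "v + simple_root i \<in> weights n" "v - simple_root i \<in> weights n"
  using assms weights_add weights_diff simple_root_weights by auto

lemma EL_in:
  assumes "v \<in> weights n" "i \<in> {1..n-1}"
  shows "EL i r v \<in> mor1 K v (v + simple_root i)"
  using E_left_adjoint[OF root_weights(1)[OF assms] assms(2), of r]
  unfolding adjoint_pair_def by simp

lemma E_word_in:
  "a \<in> weights n \<Longrightarrow> fst ` set w \<subseteq> {1..n-1} \<Longrightarrow> E_word K E w a \<in> mor1 K a (word_target w a)"
proof (induction w)
  case Nil
  then show ?case using unit1_in cells by simp
next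
  case (Cons x w)
  obtain i r where x: "x = (i, r)" by force
  have i: "i \<in> {1..n-1}" and w: "fst ` set w \<subseteq> {1..n-1}" using Cons.prems x by auto
  have v: "word_target w a \<in> weights n" using word_target_weights Cons.prems(1) w by blast
  show ?case
    unfolding x word_target.simps E_word.simps
    by (rule hc1_in[OF cellsI[OF Cons.prems(1)] cellsI[OF v] cellsI[OF root_weights(2)[OF v i]]
          Cons.IH[OF Cons.prems(1) w] E_in[OF v i]])
qed

text \<open>By \<open>EL_same\<close>, applying \<open>E i r\<close> and then \<open>EL i s\<close>
  agrees up to a shift with applying \<open>EL i (s + 1)\<close> and then
  \<open>E i (r + 1)\<close>; the latter kills \<open>P\<close> by assumption
  \<open>z\<close>.\<close>

lemma EL_E_zero:
  assumes a: "a \<in> weights n" and v: "v \<in> weights n" and i: "i \<in> {1..n-1}"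
    and P: "P \<in> mor1 K a v" and s: "1 \<le> s - r" "s - r \<le> v i + v (i + 1) - 1"
    and z: "zero_object (HomC K a (v + simple_root i)) (EL i (s + 1) v \<bullet> P)"
  shows "zero_object (HomC K a v) (EL i s (v - simple_root i) \<bullet> (E i r v \<bullet> P))"
proof -
  let ?u = "v + simple_root i" and ?t = "v - simple_root i"
  have ca: "a \<in> Cells K" and cv: "v \<in> Cells K" and cu: "?u \<in> Cells K" and ct: "?t \<in> Cells K"
    using cells a v root_weights[OF v i] by auto
  have E1: "E i (r + 1) ?u \<in> mor1 K ?u v" using E_in[OF root_weights(1)[OF v i] i, of "r + 1"] by simp
  have E0: "E i r v \<in> mor1 K v ?t" using E_in[OF v i] .
  have L1: "EL i (s + 1) v \<in> mor1 K v ?u" using EL_in[OF v i] .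
  have L0: "EL i s ?t \<in> mor1 K ?t v" using EL_in[OF root_weights(2)[OF v i] i, of s] by simp
  note LE = hc1_in[OF cv ct cv E0 L0]
  interpret H: triangulated_category "HomC K v v" using hom_triangulated cv by blast
  interpret A: triangulated_category "HomC K a v" using hom_triangulated ca cv by blast
  \<comment> \<open>\<open>EL_same\<close> lowers both indices by one, hence the instance at
    \<open>r + 1\<close> and \<open>s + 1\<close>.\<close>
  have "isomorphic (HomC K v v) (E i (r + 1) ?u \<bullet> EL i (s + 1) v) (sh (HomC K v v) (EL i s ?t \<bullet> E i r v))"
    using EL_same[OF v i, of "r + 1" "s + 1"] s by simp
  note iso = isomorphic_whisker_right[OF ca cv cv P hc1_in[OF cv cu cv L1 E1] H.shift_ob[OF LE] this]
  have "zero_object (HomC K a v) ((E i (r + 1) ?u \<bullet> EL i (s + 1) v) \<bullet> P)"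
    using zero_object_whisker_left[OF ca cu cv E1 z] hc1_assoc[OF ca cv cu cv P L1 E1] by simp
  then have "zero_object (HomC K a v) (sh (HomC K v v) (EL i s ?t \<bullet> E i r v) \<bullet> P)"
    using A.zero_object_isomorphic[OF iso] hc1_in[OF ca cv cv P H.shift_ob[OF LE]] by blast
  then have "zero_object (HomC K a v) (sh (HomC K a v) ((EL i s ?t \<bullet> E i r v) \<bullet> P))"
    using A.zero_object_isomorphic[OF shift_whisker_right[OF ca cv cv P LE]]
      A.shift_ob[OF hc1_in[OF ca cv cv P LE]] by blast
  then show ?thesis
    using A.zero_object_shift hc1_in[OF ca cv cv P LE] hc1_assoc[OF ca cv ct cv P E0 L0] by simp
qed

text \<open>When the adjoint meets the letter at position \<open>j\<close>, its index has been
  raised \<open>j\<close> times, so the last assumption keeps every difference in the range of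
  \<open>EL_same\<close>. Past the block, the adjoint acts at a weight with entry \<open>i\<close>
  equal to 0 and leads to a weight with a negative entry.\<close>

lemma EL_block_zero:
  assumes a: "a \<in> weights n" and w: "fst ` set w \<subseteq> {1..n-1}" and i: "i \<in> {1..n-1}"
    and ti: "word_target w a i = 0"
    and s: "\<And>j. j < length l \<Longrightarrow>
      1 \<le> s + int j - l ! j \<and> s + int j - l ! j \<le> word_target w a (i + 1) - 1"
  shows "zero_object (HomC K a (word_target (map (Pair i) l @ w) a + simple_root i))
    (EL i s (word_target (map (Pair i) l @ w) a) \<bullet> E_word K E (map (Pair i) l @ w) a)"
  using s
proof (induction l arbitrary: s)
  case Nil
  have v: "word_target w a \<in> weights n" using word_target_weights a w .
  have "(word_target w a + simple_root i) i = -1" using ti by (simp add: simple_root_def)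
  then have nc: "word_target w a + simple_root i \<notin> compositions n N"
    using i unfolding compositions_def by force
  have "zero_object (HomC K (word_target w a) (word_target w a + simple_root i)) (EL i s (word_target w a))"
    using zero_mor1[OF v root_weights(1)[OF v i]] nc EL_in[OF v i] by blast
  then show ?case
    unfolding list.map append_Nil
    by (rule zero_object_whisker_right[OF cellsI[OF a] cellsI[OF v]
          cellsI[OF root_weights(1)[OF v i]] E_word_in[OF a w]])
next
  case (Cons r l)
  let ?w = "map (Pair i) l @ w"
  have w': "fst ` set ?w \<subseteq> {1..n-1}" using w i by auto
  have v: "word_target ?w a \<in> weights n" using word_target_weights a w' .
  have z: "zero_object (HomC K a (word_target ?w a + simple_root i))
      (EL i (s + 1) (word_target ?w a) \<bullet> E_word K E ?w a)"
  proof (rule Cons.IH)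
    fix j assume "j < length l"
    then show "1 \<le> s + 1 + int j - l ! j \<and> s + 1 + int j - l ! j \<le> word_target w a (i + 1) - 1"
      using Cons.prems[of "Suc j"] by (simp add: algebra_simps)
  qed
  \<comment> \<open>Letters \<open>i\<close> only move units between entries \<open>i\<close> and
    \<open>i + 1\<close>, so the sum that bounds the range of \<open>EL_same\<close> is constant
    along the block.\<close>
  have "word_target ?w a i + word_target ?w a (i + 1) = word_target w a (i + 1)"
    using ti by (simp add: word_target_block)
  then have "1 \<le> s - r" "s - r \<le> word_target ?w a i + word_target ?w a (i + 1) - 1"
    using Cons.prems[of 0] by auto
  then show ?case
    unfolding list.map append_Cons word_target.simps E_word.simps add_diff_cancel diff_add_cancel
    by (rule EL_E_zero[OF a v i E_word_in[OF a w'] _ _ z])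
qed

text \<open>
  Whiskering the triangle of (3) with P exhibits \<open>E\<^sup>L\<^sub>i\<^sub>,\<^sub>r E\<^sub>i\<^sub>,\<^sub>r P\<close> as abstractly isomorphic to P.
\<close>

lemma E_hom_ff:
  assumes a: "a \<in> weights n" and v: "v \<in> weights n" and i: "i \<in> {1..n-1}"
    and P: "hom_ff K a v P"
    and z: "zero_object (HomC K a (v + simple_root i)) (EL i (r + 1) v \<bullet> P)"
  shows "hom_ff K a (v - simple_root i) (E i r v \<bullet> P)"
    and "Q \<in> mor1 K a v \<Longrightarrow> bij_betw (\<lambda>\<beta>. ide (HomC K v (v - simple_root i)) (E i r v) \<star> \<beta>)
      (mor2 K a v P Q) (mor2 K a (v - simple_root i) (E i r v \<bullet> P) (E i r v \<bullet> Q))"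
proof -
  let ?u = "v + simple_root i" and ?t = "v - simple_root i"
  have ca: "a \<in> Cells K" and cv: "v \<in> Cells K" and cu: "?u \<in> Cells K" and ct: "?t \<in> Cells K"
    using cells a v root_weights[OF v i] by auto
  have P1: "P \<in> mor1 K a v" using P unfolding hom_ff_def by blast
  have E1: "E i (r + 1) ?u \<in> mor1 K ?u v" using E_in[OF root_weights(1)[OF v i] i, of "r + 1"] by simp
  have E0: "E i r v \<in> mor1 K v ?t" using E_in[OF v i] .
  have L1: "EL i (r + 1) v \<in> mor1 K v ?u" using EL_in[OF v i] .
  have L0: "EL i r ?t \<in> mor1 K ?t v" using EL_in[OF root_weights(2)[OF v i] i, of r] by simp
  interpret A: triangulated_category "HomC K a v" using hom_triangulated ca cv by blast
  \<comment> \<open>Taken at \<open>r + 1\<close>, the triangle has the wanted first term, and its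
    third term contains \<open>EL i (r + 1) v \<bullet> P\<close>, which is zero.\<close>
  have "exact_triangle (HomC K a v) ((EL i r ?t \<bullet> E i r v) \<bullet> P) (unit1 K v \<bullet> P)
      ((E i (r + 1) ?u \<bullet> EL i (r + 1) v) \<bullet> P)"
    using triangle_whisker_right[OF ca cv cv P1 triangle_left[OF v i, of "r + 1"]] by simp
  then obtain f g h where "(EL i r ?t \<bullet> (E i r v \<bullet> P), P, E i (r + 1) ?u \<bullet> (EL i (r + 1) v \<bullet> P), f, g, h)
      \<in> Tri (HomC K a v)"
    unfolding exact_triangle_def
    using hc1_assoc[OF ca cv ct cv P1 E0 L0] hc1_assoc[OF ca cv cu cv P1 L1 E1]
      unit1_left[OF ca cv P1] by auto
  then have "isomorphic (HomC K a v) (EL i r ?t \<bullet> (E i r v \<bullet> P)) P"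
    using A.triangle_zero_cone_iso zero_object_whisker_left[OF ca cu cv E1 z]
    unfolding isomorphic_def by blast
  note step = hom_ff_right_adjoint[OF ca cv ct E_left_adjoint[OF v i] P this]
  show "hom_ff K a ?t (E i r v \<bullet> P)"
    and "Q \<in> mor1 K a v \<Longrightarrow> bij_betw (\<lambda>\<beta>. ide (HomC K v ?t) (E i r v) \<star> \<beta>)
      (mor2 K a v P Q) (mor2 K a ?t (E i r v \<bullet> P) (E i r v \<bullet> Q))"
    using step by blast+
qed

text \<open>Parts below \<open>s\<close> give the lower bound on each difference. Nonnegative parts
  and \<open>j \<le> length l - 1\<close> reduce the upper bound to the size condition on
  \<open>s\<close>.\<close>

lemma EL_diagram_zero:
  assumes a: "a \<in> weights n" and w: "fst ` set w \<subseteq> {1..n-1}" and i: "i \<in> {1..n-1}"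
    and ti: "word_target w a i = 0" and l: "l \<in> young_diagrams c (int (length l))"
    and s: "\<forall>x\<in>set l. x < s" "s + int (length l) \<le> word_target w a (i + 1)"
  shows "zero_object (HomC K a (word_target (map (Pair i) l @ w) a + simple_root i))
    (EL i s (word_target (map (Pair i) l @ w) a) \<bullet> E_word K E (map (Pair i) l @ w) a)"
proof (rule EL_block_zero[OF a w i ti])
  fix j assume j: "j < length l"
  then have "l ! j < s" "0 \<le> l ! j" using s(1) young_diagrams_nth[OF l] by auto
  then show "1 \<le> s + int j - l ! j \<and> s + int j - l ! j \<le> word_target w a (i + 1) - 1"
    using j s(2) by linarith
qed

text \<open>Parts are prepended in weakly increasing order, so the new part \<open>r\<close> bounds
  those already present and \<open>EL i (r + 1)\<close> kills their block.\<close>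

lemma block_hom_ff:
  assumes a: "a \<in> weights n" and w: "fst ` set w \<subseteq> {1..n-1}" and i: "i \<in> {1..n-1}"
    and ti: "word_target w a i = 0" and ff: "hom_ff K a (word_target w a) (E_word K E w a)"
    and l: "l \<in> young_diagrams c (int (length l))" "c + int (length l) \<le> word_target w a (i + 1)"
  shows "hom_ff K a (word_target (map (Pair i) l @ w) a) (E_word K E (map (Pair i) l @ w) a)"
  using l
proof (induction l)
  case Nil
  then show ?case using ff by simp
next
  case (Cons r l)
  let ?w = "map (Pair i) l @ w"
  have w': "fst ` set ?w \<subseteq> {1..n-1}" using w i by auto
  have v: "word_target ?w a \<in> weights n" using word_target_weights a w' .
  have l: "l \<in> young_diagrams c (int (length l))" "r \<le> c" "\<forall>x\<in>set l. x < r + 1"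
    using young_diagrams_Cons[OF Cons.prems(1)] by auto
  \<comment> \<open>The 1 in \<open>r + 1\<close> is paid for by the letter \<open>r\<close> itself,
    which is counted in the length in \<open>Cons.prems\<close> but not in that of
    \<open>l\<close>.\<close>
  have z: "zero_object (HomC K a (word_target ?w a + simple_root i))
      (EL i (r + 1) (word_target ?w a) \<bullet> E_word K E ?w a)"
    using EL_diagram_zero[OF a w i ti l(1,3)] l(2) Cons.prems(2) by simp
  have "c + int (length l) \<le> word_target w a (i + 1)" using Cons.prems(2) by simp
  then show ?case
    unfolding list.map append_Cons word_target.simps E_word.simps
    by (rule E_hom_ff(1)[OF a v i Cons.IH[OF l(1)] z])
qed

text \<open>If the first parts satisfy \<open>r < r'\<close>, then \<open>EL i r'\<close> kills the
  source and adjunction applies; if they agree, \<open>E_hom_ff\<close> cancels them. The second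
  alternative of \<open>less\<close> covers equal blocks, where vanishing is inherited from
  \<open>w\<close> and \<open>w'\<close>. The assumption \<open>same\<close> places both sides in
  one Hom category.\<close>

lemma block_hom_zero:
  assumes a: "a \<in> weights n" and w: "fst ` set w \<subseteq> {1..n-1}" and w': "fst ` set w' \<subseteq> {1..n-1}"
    and i: "i \<in> {1..n-1}" and ti: "word_target w a i = 0"
    and same: "word_target w' a = word_target w a"
    and ff: "hom_ff K a (word_target w a) (E_word K E w a)"
    and l: "l \<in> young_diagrams c (int (length l))" "c + int (length l) \<le> word_target w a (i + 1)"
    and l': "l' \<in> young_diagrams c (int (length l))"
    and less: "lex_less l l' \<or> l = l' \<and> mor2 K a (word_target w a) (E_word K E w a) (E_word K E w' a)
      = {\<zero>\<^bsub>Mor (HomC K a (word_target w a)) (E_word K E w a) (E_word K E w' a)\<^esub>}"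
  shows "mor2 K a (word_target (map (Pair i) l @ w) a)
      (E_word K E (map (Pair i) l @ w) a) (E_word K E (map (Pair i) l' @ w') a)
    = {\<zero>\<^bsub>Mor (HomC K a (word_target (map (Pair i) l @ w) a))
        (E_word K E (map (Pair i) l @ w) a) (E_word K E (map (Pair i) l' @ w') a)\<^esub>}"
  using l l' less
proof (induction l arbitrary: l')
  \<comment> \<open>Both diagrams are empty, so \<open>lex_less\<close> fails and the second
    alternative remains.\<close>
  case Nil
  then show ?case by (auto simp: lex_less_def young_diagrams_def)
next
  case (Cons r l)
  obtain r' m where m: "l' = r' # m"
    using Cons.prems(3) by (cases l') (auto simp: young_diagrams_def)
  let ?w = "map (Pair i) l @ w" and ?w' = "map (Pair i) m @ w'"
  let ?v = "word_target ?w a"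
  have lw: "fst ` set ?w \<subseteq> {1..n-1}" and lw': "fst ` set ?w' \<subseteq> {1..n-1}" using w w' i by auto
  have v: "?v \<in> weights n" using word_target_weights a lw .
  have t: "?v - simple_root i \<in> weights n" using root_weights[OF v i] by blast
  have l: "l \<in> young_diagrams c (int (length l))" "r \<le> c" "\<forall>x\<in>set l. x < r + 1"
    using young_diagrams_Cons[OF Cons.prems(1)] by auto
  have m': "m \<in> young_diagrams c (int (length l))" "r' \<le> c"
    using young_diagrams_Cons Cons.prems(3) m by fastforce+
  then have "length m = length l" by (simp add: young_diagrams_def)
  then have v': "word_target ?w' a = ?v" by (simp only: word_target_block same)
  have Q: "E_word K E ?w' a \<in> mor1 K a ?v" using E_word_in[OF a lw'] v' by simp
  have ca: "a \<in> Cells K" and cv: "?v \<in> Cells K" and ct: "?v - simple_root i \<in> Cells K"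
    using cells a v t by auto
  have len: "c + int (length l) + 1 \<le> word_target w a (i + 1)" using Cons.prems(2) by simp
  have lff: "hom_ff K a ?v (E_word K E ?w a)"
    using block_hom_ff[OF a w i ti ff l(1)] len by simp
  consider "r < r'" | "r = r'" "lex_less l m \<or> l = m \<and>
      mor2 K a (word_target w a) (E_word K E w a) (E_word K E w' a)
      = {\<zero>\<^bsub>Mor (HomC K a (word_target w a)) (E_word K E w a) (E_word K E w' a)\<^esub>}"
    using Cons.prems(4) unfolding m lex_less_Cons by auto
  then show ?case
  proof cases
    case 1
    \<comment> \<open>\<open>r\<close> is the largest part of the source, so the vanishing applies
      to the full block including \<open>r\<close>; the size condition follows from
      \<open>r' \<le> c\<close>.\<close>
    have "\<forall>x\<in>set (r # l). x < r'" using l(3) 1 by auto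
    then have "zero_object (HomC K a ?v)
        (EL i r' (?v - simple_root i) \<bullet> (E i r ?v \<bullet> E_word K E ?w a))"
      using EL_diagram_zero[OF a w i ti Cons.prems(1), of r'] m'(2) len by simp
    then show ?thesis
      unfolding m list.map append_Cons word_target.simps E_word.simps v'
      by (rule hom_right_adjoint_zero[OF ca cv ct E_left_adjoint[OF v i]
            hc1_in[OF ca cv ct E_word_in[OF a lw] E_in[OF v i]] Q])
  next
    case 2
    have z: "zero_object (HomC K a (?v + simple_root i)) (EL i (r + 1) ?v \<bullet> E_word K E ?w a)"
      using EL_diagram_zero[OF a w i ti l(1,3)] l(2) len by simp
    have IH: "mor2 K a ?v (E_word K E ?w a) (E_word K E ?w' a)
        = {\<zero>\<^bsub>Mor (HomC K a ?v) (E_word K E ?w a) (E_word K E ?w' a)\<^esub>}"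
      using Cons.IH[OF l(1) _ m'(1) 2(2)] len by simp
    \<comment> \<open>The Hom space is the image of the zero space \<open>IH\<close> under a linear
      map, whose surjectivity comes from the cancellation of \<open>E i r\<close>.\<close>
    have "mor2 K a (?v - simple_root i) (E i r ?v \<bullet> E_word K E ?w a) (E i r ?v \<bullet> E_word K E ?w' a)
        = (\<lambda>\<beta>. ide (HomC K ?v (?v - simple_root i)) (E i r ?v) \<star> \<beta>) `
          mor2 K a ?v (E_word K E ?w a) (E_word K E ?w' a)"
      using E_hom_ff(2)[OF a v i lff z Q] by (simp add: bij_betw_def)
    also have "\<dots> = {\<zero>\<^bsub>Mor (HomC K a (?v - simple_root i)) (E i r ?v \<bullet> E_word K E ?w a)
        (E i r ?v \<bullet> E_word K E ?w' a)\<^esub>}"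
      unfolding IH using linear_functor_zero[OF hom_lin[OF ca cv] hom_lin[OF ca ct]
          whisker_left[OF ca cv ct E_in[OF v i]] E_word_in[OF a lw] Q] by simp
    finally show ?thesis
      unfolding m list.map append_Cons word_target.simps E_word.simps v' 2(1)[symmetric] .
  qed
qed

text \<open>\<open>block_hom_ff\<close> is applied with \<open>c = k (i + 1)\<close> at the tail
  \<open>Suc i\<close>. Its size condition holds with equality, because the sides of the box add up
  to entry \<open>i + 1\<close> of the weight reached.\<close>

lemma tail_hom_ff:
  assumes n: "1 \<le> n" and k: "k \<in> compositions n N" and \<mu>: "diagram_tuple n k \<mu>"
    and i: "1 \<le> i" "i \<le> n"
  shows "hom_ff K (highest_weight n N) (word_target (tail_word n \<mu> i) (highest_weight n N))
    (E_word K E (tail_word n \<mu> i) (highest_weight n N))"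
  using i(2,1)
proof (induction i rule: inc_induct)
  case base
  then show ?case
    using hom_ff_unit1 cells highest_weight_weights[OF n] by (simp add: tail_word_end)
next
  case (step i)
  have i: "i \<in> {1..n-1}" using step by auto
  have d: "\<mu> i \<in> young_diagrams (k (i + 1)) (int (length (\<mu> i)))"
    and len: "int (length (\<mu> i)) = (\<Sum>m=1..i. k m)"
    using \<mu> i by (auto simp: diagram_tuple_def young_diagrams_def)
  show ?case
    unfolding tail_word_step[OF step(2)]
  proof (rule block_hom_ff[OF highest_weight_weights[OF n] _ i _ _ d])
    show "fst ` set (tail_word n \<mu> (Suc i)) \<subseteq> {1..n-1}" by (rule tail_word_letters) simp
  qed (use step len tail_target[OF k \<mu>, of "Suc i"] in auto)
qed

text \<open>\<open>less\<close> is the product order restricted to the blocks from \<open>i\<close>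
  on. If the first differing block \<open>p\<close> is \<open>i\<close>, the first alternative of
  \<open>block_hom_zero\<close> holds; otherwise the blocks at \<open>i\<close> agree and the
  induction hypothesis gives the second.\<close>

lemma tail_hom_zero:
  assumes n: "1 \<le> n" and k: "k \<in> compositions n N"
    and \<mu>: "diagram_tuple n k \<mu>" and \<nu>: "diagram_tuple n k \<nu>" and i: "1 \<le> i" "i \<le> n"
    and less: "\<exists>p\<in>{i..n-1}. (\<forall>j\<in>{i..<p}. \<mu> j = \<nu> j) \<and> lex_less (\<mu> p) (\<nu> p)"
  shows "mor2 K (highest_weight n N) (word_target (tail_word n \<mu> i) (highest_weight n N))
      (E_word K E (tail_word n \<mu> i) (highest_weight n N))
      (E_word K E (tail_word n \<nu> i) (highest_weight n N))
    = {\<zero>\<^bsub>Mor (HomC K (highest_weight n N) (word_target (tail_word n \<mu> i) (highest_weight n N)))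
        (E_word K E (tail_word n \<mu> i) (highest_weight n N))
        (E_word K E (tail_word n \<nu> i) (highest_weight n N))\<^esub>}"
  using i(2,1) less
proof (induction i rule: inc_induct)
  \<comment> \<open>The interval \<open>{n..n-1}\<close> is empty as \<open>n\<close> is positive,
    so \<open>less\<close> cannot hold.\<close>
  case base
  then show ?case by auto
next
  case (step i)
  have i: "i \<in> {1..n-1}" using step by auto
  have d: "\<mu> i \<in> young_diagrams (k (i + 1)) (int (length (\<mu> i)))"
    and d': "\<nu> i \<in> young_diagrams (k (i + 1)) (int (length (\<mu> i)))"
    and len: "int (length (\<mu> i)) = (\<Sum>m=1..i. k m)"
    using \<mu> \<nu> i by (auto simp: diagram_tuple_def young_diagrams_def)
  obtain p where p: "p \<in> {i..n-1}" "\<forall>j\<in>{i..<p}. \<mu> j = \<nu> j" "lex_less (\<mu> p) (\<nu> p)"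
    using step.prems by blast
  have less: "lex_less (\<mu> i) (\<nu> i) \<or> \<mu> i = \<nu> i \<and>
    mor2 K (highest_weight n N) (word_target (tail_word n \<mu> (Suc i)) (highest_weight n N))
      (E_word K E (tail_word n \<mu> (Suc i)) (highest_weight n N))
      (E_word K E (tail_word n \<nu> (Suc i)) (highest_weight n N))
    = {\<zero>\<^bsub>Mor (HomC K (highest_weight n N) (word_target (tail_word n \<mu> (Suc i)) (highest_weight n N)))
        (E_word K E (tail_word n \<mu> (Suc i)) (highest_weight n N))
        (E_word K E (tail_word n \<nu> (Suc i)) (highest_weight n N))\<^esub>}"
  proof (cases "p = i")
    case True
    then show ?thesis using p(3) by simp
  next
    case False
    then have "\<exists>p\<in>{Suc i..n-1}. (\<forall>j\<in>{Suc i..<p}. \<mu> j = \<nu> j) \<and> lex_less (\<mu> p) (\<nu> p)"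
      using p by (intro bexI[of _ p]) auto
    moreover have "\<mu> i = \<nu> i" using p False by auto
    ultimately show ?thesis using step.IH by simp
  qed
  show ?case
    unfolding tail_word_step[OF step(2)]
  proof (rule block_hom_zero[OF highest_weight_weights[OF n] _ _ i _ _ _ d _ d' less])
    show "fst ` set (tail_word n \<mu> (Suc i)) \<subseteq> {1..n-1}"
      "fst ` set (tail_word n \<nu> (Suc i)) \<subseteq> {1..n-1}" by (rule tail_word_letters, simp)+
    show "hom_ff K (highest_weight n N) (word_target (tail_word n \<mu> (Suc i)) (highest_weight n N))
        (E_word K E (tail_word n \<mu> (Suc i)) (highest_weight n N))"
      using tail_hom_ff[OF n k \<mu>, of "Suc i"] step by simp
  qed (use step len tail_target[OF k \<mu>, of "Suc i"] tail_target[OF k \<nu>, of "Suc i"] in auto)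
qed

end

theorem theorem4p17:
  fixes n N :: nat
    and K :: "(weight, 'f, 'm, 'o, 'p) two_cat"
    and E EL ER :: "nat \<Rightarrow> int \<Rightarrow> weight \<Rightarrow> 'f"
    and k \<eta> :: weight
  assumes "n \<ge> 2" and "N \<ge> 2"
    and "categorical_Un_plus_action n N K E EL ER"
    and "k \<in> compositions n N"
    and "\<eta> = highest_weight n N"
  shows "(\<forall>\<mu>. diagram_tuple n k \<mu> \<longrightarrow>
            fully_faithful (Und K \<eta>) (Und K k)
              (actO K (E_tuple n K E \<mu> \<eta>)) (actM K (E_tuple n K E \<mu> \<eta>))
          \<and> linear_iso (Mor (HomC K \<eta> \<eta>) (unit1 K \<eta>) (unit1 K \<eta>))
              (Mor (HomC K \<eta> k) (E_tuple n K E \<mu> \<eta>) (E_tuple n K E \<mu> \<eta>))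
              (\<lambda>\<alpha>. hc2 K (ide (HomC K \<eta> k) (E_tuple n K E \<mu> \<eta>)) \<alpha>))
       \<and> (\<forall>\<mu> \<nu>. diagram_tuple n k \<mu> \<longrightarrow> diagram_tuple n k \<nu> \<longrightarrow> product_lex_less n \<mu> \<nu> \<longrightarrow>
            mor2 K \<eta> k (E_tuple n K E \<mu> \<eta>) (E_tuple n K E \<nu> \<eta>)
              = {\<zero>\<^bsub>Mor (HomC K \<eta> k) (E_tuple n K E \<mu> \<eta>) (E_tuple n K E \<nu> \<eta>)\<^esub>})"
proof -
  interpret categorical_Un_plus_action n N K E EL ER by fact
  have n: "1 \<le> n" using assms(1) by simp
  \<comment> \<open>Weights are functions on all naturals, and \<open>tail_target\<close> at
    \<open>i = 1\<close> gives 0 at position 0; equality with \<open>k\<close> has to be checked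
    there as well.\<close>
  have k0: "k 0 = 0" using assms(4) by (simp add: compositions_def weights_def)
  have c\<eta>: "\<eta> \<in> Cells K" using cells highest_weight_weights[OF n] assms(5) by simp
  have ck: "k \<in> Cells K" using cells assms(4) by (simp add: compositions_def)
  have t: "word_target (tail_word n \<mu> 1) \<eta> = k" if "diagram_tuple n k \<mu>" for \<mu>
    using tail_target[OF assms(4) that, of 1] n k0 by (auto simp: assms(5) fun_eq_iff)
  have ff: "hom_ff K \<eta> k (E_tuple n K E \<mu> \<eta>)" if "diagram_tuple n k \<mu>" for \<mu>
    using tail_hom_ff[OF n assms(4) that, of 1] n t[OF that]
    by (simp add: E_tuple_def tuple_word_eq assms(5))
  have "linear_iso (Mor (HomC K \<eta> \<eta>) (unit1 K \<eta>) (unit1 K \<eta>))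
      (Mor (HomC K \<eta> k) (E_tuple n K E \<mu> \<eta>) (E_tuple n K E \<mu> \<eta>))
      (\<lambda>\<alpha>. hc2 K (ide (HomC K \<eta> k) (E_tuple n K E \<mu> \<eta>)) \<alpha>)" if "diagram_tuple n k \<mu>" for \<mu>
  proof -
    have P: "E_tuple n K E \<mu> \<eta> \<in> mor1 K \<eta> k" using ff[OF that] unfolding hom_ff_def by blast
    \<comment> \<open>Linearity comes from the whiskering functor and bijectivity from
      \<open>hom_ff\<close>; \<open>unit1_right\<close> identifies the image of the unit with the
      1-morphism itself.\<close>
    show ?thesis
      using linear_functor_map[OF whisker_left[OF c\<eta> c\<eta> ck P] unit1_in[OF c\<eta>] unit1_in[OF c\<eta>]]
        unit1_right[OF c\<eta> ck P] ff[OF that]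
      unfolding linear_iso_def hom_ff_def by simp
  qed
  moreover have "mor2 K \<eta> k (E_tuple n K E \<mu> \<eta>) (E_tuple n K E \<nu> \<eta>)
      = {\<zero>\<^bsub>Mor (HomC K \<eta> k) (E_tuple n K E \<mu> \<eta>) (E_tuple n K E \<nu> \<eta>)\<^esub>}"
    if "diagram_tuple n k \<mu>" "diagram_tuple n k \<nu>" "product_lex_less n \<mu> \<nu>" for \<mu> \<nu>
    using tail_hom_zero[OF n assms(4) that(1,2), of 1] that(3) n t[OF that(1)]
    by (simp add: E_tuple_def tuple_word_eq assms(5) product_lex_less_def)
  ultimately show ?thesis
    using ff unfolding hom_ff_def by blast
qed

end
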